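(* For a class of graphs $\mathcal{G}$, the following statements are equivalent. (a) $\mathcal{G}$ is nowhere-dense. (b) There exists a function $f:\mathbb{Z}_{\ge 0}\times\mathbb{Z}_{\ge 0}\to\mathbb{Z}_{\ge 0}$, subpolynomial in the second argument, such that for every non-negative integer $k$ and every graph $G\in\mathcal{G}$, every induced subgraph $G'$ of $G$ satisfies $\widetilde{\nabla}^\circ_k(G')\le f(k,|V(G')|)$. (c) There exists a function $f:\mathbb{Z}_{\ge 0}\times\mathbb{Z}_{\ge 0}\to\mathbb{Z}_{\ge 0}$, subpolynomial in the second argument, such that for every non-negative integer $k$ and every graph $G\in\mathcal{G}$, every induced subgraph $G'$ of $G$ satisfies $\widetilde{\nabla}^e_k(G')\le f(k,|V(G')|)$.
   Context: Graphs (including subgraphs) are finite, simple, undirected, and have at least one vertex. The average degree of a graph $F$ is $2|E(F)|/|V(F)|$. For a non-negative integer $k$, a $(\le k)$-subdivision of a graph $F$ is a graph obtained from $F$ by subdividing each of its edges by at most $k$ vertices (not necessarily the same number on each edge). The $k$-subdivision of $F$ is the graph obtained from $F$ by subdividing each edge exactly $k$ times. For a graph $G$ and a non-negative integer $k$: - $\widetilde{\nabla}^\circ_k(G)$ is the maximum of the average degrees of graphs $F$ such that some $(\le k)$-subdivision of $F$ appears as an induced subgraph of $G$; - $\widetilde{\nabla}^e_k(G)$ is the maximum of the average degrees of graphs $F$ such that the $k$-subdivision of $F$ appears as an induced subgraph of $G$. A class of graphs $\mathcal{G}$ is nowhere-dense if there exists a function $h:\mathbb{Z}_{\ge 0}\to\mathbb{Z}_{\ge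 0}$ such that for every $G\in\mathcal{G}$ and every non-negative integer $k$, $G$ does not contain any $(\le k)$-subdivision of the complete graph $K_{h(k)}$ as a (not necessarily induced) subgraph. A function $g:\mathbb{Z}_{\ge 0}\to\mathbb{Z}_{\ge 0}$ is subpolynomial if $\lim_{n\to\infty}\frac{\log g(n)}{\log n}=0$. A function $f:\mathbb{Z}_{\ge 0}\times\mathbb{Z}_{\ge 0}\to\mathbb{Z}_{\ge 0}$ is subpolynomial in the second argument if for every non-negative integer $k$ the function $n\mapsto f(k,n)$ is subpolynomial. *)

theory Defs
  imports Complex_Main "Graph_Theory.Graph_Theory"
begin

text \<open>
  An undirected graph is a symmetric loop-free digraph without parallel arcs, so each undirected
  edge is a pair of opposite arcs. The library's \<open>pair_graph\<close> admits the null graph, which is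
  excluded here.
\<close>

definition simple_graph :: "'a pair_pre_digraph \<Rightarrow> bool" where
  "simple_graph G \<longleftrightarrow> pair_graph G \<and> pverts G \<noteq> {}"

text \<open>Every undirected edge gives two arcs, hence \<open>card (parcs F)\<close> is already \<open>2|E(F)|\<close>.\<close>

definition avg_degree :: "'a pair_pre_digraph \<Rightarrow> real" where
  "avg_degree F = real (card (parcs F)) / real (card (pverts F))"

definition contains_subgraph :: "'a pair_pre_digraph \<Rightarrow> 'b pair_pre_digraph \<Rightarrow> bool" where
  "contains_subgraph G H \<longleftrightarrow>
     (\<exists>K. subgraph (with_proj K) (with_proj G) \<and> digraph_iso (with_proj H) (with_proj K))"

definition contains_induced_subgraph :: "'a pair_pre_digraph \<Rightarrow> 'b pair_pre_digraph \<Rightarrow> bool" where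
  "contains_induced_subgraph G H \<longleftrightarrow>
     (\<exists>K. induced_subgraph (with_proj K) (with_proj G) \<and> digraph_iso (with_proj H) (with_proj K))"

text \<open>
  To subdivide the undirected edges individually, each of them is represented by its increasing
  arc. The edge \<open>e\<close> is replaced by the path
  \<open>sd_vertex s e 0, \<dots>, sd_vertex s e (s e + 1)\<close>, whose ends are the ends of \<open>e\<close> and whose
  \<open>s e\<close> inner vertices \<open>Inr (e, 1), \<dots>, Inr (e, s e)\<close> are new.
\<close>

definition edge_reps :: "'a::linorder pair_pre_digraph \<Rightarrow> ('a \<times> 'a) set" where
  "edge_reps F = {e \<in> parcs F. fst e < snd e}"

definition sd_vertex :: "('a \<times> 'a \<Rightarrow> nat) \<Rightarrow> 'a \<times> 'a \<Rightarrow> nat \<Rightarrow> 'a + ('a \<times> 'a) \<times> nat" where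
  "sd_vertex s e i =
     (if i = 0 then Inl (fst e) else if i \<le> s e then Inr (e, i) else Inl (snd e))"

definition sd_arcs ::
  "'a::linorder pair_pre_digraph \<Rightarrow> ('a \<times> 'a \<Rightarrow> nat) \<Rightarrow> ('a + ('a \<times> 'a) \<times> nat) rel" where
  "sd_arcs F s = {(sd_vertex s e i, sd_vertex s e (i + 1)) | e i. e \<in> edge_reps F \<and> i \<le> s e}"

definition subdivided ::
  "'a::linorder pair_pre_digraph \<Rightarrow> ('a \<times> 'a \<Rightarrow> nat) \<Rightarrow> ('a + ('a \<times> 'a) \<times> nat) pair_pre_digraph" where
  "subdivided F s =
     \<lparr> pverts = Inl ` pverts F \<union> {Inr (e, i) | e i. e \<in> edge_reps F \<and> 1 \<le> i \<and> i \<le> s e},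
       parcs = sd_arcs F s \<union> (sd_arcs F s)\<inverse> \<rparr>"

definition le_subdivisions ::
  "nat \<Rightarrow> 'a::linorder pair_pre_digraph \<Rightarrow> ('a + ('a \<times> 'a) \<times> nat) pair_pre_digraph set" where
  "le_subdivisions k F = {subdivided F s | s. \<forall>e \<in> edge_reps F. s e \<le> k}"

definition k_subdivision ::
  "nat \<Rightarrow> 'a::linorder pair_pre_digraph \<Rightarrow> ('a + ('a \<times> 'a) \<times> nat) pair_pre_digraph" where
  "k_subdivision k F = subdivided F (\<lambda>_. k)"

text \<open>
  Containment is up to isomorphism, so graphs \<open>F\<close> with natural numbers as vertices represent all
  finite graphs. The sets below are finite and nonempty whenever \<open>G\<close> is a simple graph
  (lemmas \<open>nabla_le_values\<close> and \<open>nabla_eq_values\<close>), so the maxima are attained.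
\<close>

definition nabla_le :: "nat \<Rightarrow> 'a pair_pre_digraph \<Rightarrow> real" where
  "nabla_le k G = Max {avg_degree F | F :: nat pair_pre_digraph.
     simple_graph F \<and> (\<exists>H \<in> le_subdivisions k F. contains_induced_subgraph G H)}"

definition nabla_eq :: "nat \<Rightarrow> 'a pair_pre_digraph \<Rightarrow> real" where
  "nabla_eq k G = Max {avg_degree F | F :: nat pair_pre_digraph.
     simple_graph F \<and> contains_induced_subgraph G (k_subdivision k F)}"

text \<open>
  The value \<open>h k = 0\<close> does not trivialise the condition: the null graph \<open>K\<^sub>0\<close> counts as contained
  in every graph, so \<open>h k\<close> is positive as soon as the class has a member.
\<close>

definition nowhere_dense :: "'a pair_pre_digraph set \<Rightarrow> bool" where
  "nowhere_dense \<G> \<longleftrightarrow> (\<exists>h :: nat \<Rightarrow> nat. \<forall>G \<in> \<G>. \<forall>k.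
     \<not> (\<exists>F :: nat pair_pre_digraph. complete_digraph (h k) (with_proj F) \<and>
          (\<exists>H \<in> le_subdivisions k F. contains_subgraph G H)))"

text \<open>
  As \<open>ln 0 = 0\<close> in HOL, positivity for large \<open>n\<close> is stated separately: otherwise the quotient
  would not have its usual meaning.
\<close>

definition subpolynomial :: "(nat \<Rightarrow> nat) \<Rightarrow> bool" where
  "subpolynomial g \<longleftrightarrow> (\<forall>\<^sub>F n in sequentially. 0 < g n) \<and>
     (\<lambda>n. ln (real (g n)) / ln (real n)) \<longlonglongrightarrow> 0"

definition subpolynomial_snd :: "(nat \<Rightarrow> nat \<Rightarrow> nat) \<Rightarrow> bool" where
  "subpolynomial_snd f \<longleftrightarrow> (\<forall>k. subpolynomial (f k))"


lemma sd_vertex_in: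
  assumes "pair_graph F" "e \<in> edge_reps F" "i \<le> s e + 1"
  shows "sd_vertex s e i \<in> pverts (subdivided F s)"
proof -
  interpret pair_graph F by fact
  have "e \<in> parcs F" using assms(2) by (simp add: edge_reps_def)
  then show ?thesis using assms(2)
    by (cases e) (auto dest: in_arcsD1 in_arcsD2 simp: sd_vertex_def subdivided_def)
qed

lemma pair_graph_subdivided:
  assumes "pair_graph F"
  shows "pair_graph (subdivided F s)"
proof -
  interpret F: pair_graph F by fact
  have fin: "finite (edge_reps F)"
    unfolding edge_reps_def using F.pair_finite_arcs by simp
  have "{Inr (e, i) | e i. e \<in> edge_reps F \<and> 1 \<le> i \<and> i \<le> s e}
      = Inr ` (SIGMA e : edge_reps F. {1..s e})" by auto
  moreover have "finite (Inr ` (SIGMA e : edge_reps F. {1..s e}) :: ('a + ('a \<times> 'a) \<times> nat) set)"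
    using fin by blast
  ultimately have fini: "finite {Inr (e, i) :: 'a + ('a \<times> 'a) \<times> nat | e i.
      e \<in> edge_reps F \<and> 1 \<le> i \<and> i \<le> s e}"
    by (rule ssubst)
  have finv: "finite (pverts (subdivided F s))"
    unfolding subdivided_def pair_pre_digraph.select_convs
    by (rule finite_UnI[OF finite_imageI[OF F.pair_finite_verts] fini])
  have "sd_arcs F s = (\<lambda>(e, i). (sd_vertex s e i, sd_vertex s e (i + 1))) `
      (SIGMA e : edge_reps F. {..s e})"
    unfolding sd_arcs_def by force
  then have fina: "finite (parcs (subdivided F s))"
    using fin by (simp add: subdivided_def)
  have arc: "fst a \<in> pverts (subdivided F s) \<and> snd a \<in> pverts (subdivided F s) \<and> fst a \<noteq> snd a"
    if "a \<in> parcs (subdivided F s)" for a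
  proof -
    from that obtain e i where e: "e \<in> edge_reps F" "i \<le> s e" and
      a: "a = (sd_vertex s e i, sd_vertex s e (i + 1)) \<or> a = (sd_vertex s e (i + 1), sd_vertex s e i)"
      by (auto simp: subdivided_def sd_arcs_def)
    have "sd_vertex s e i \<noteq> sd_vertex s e (i + 1)"
      using e by (auto simp: sd_vertex_def edge_reps_def)
    then show ?thesis using a e sd_vertex_in[OF assms, of e _ s] by auto
  qed
  have "symmetric (with_proj (subdivided F s))"
    by (auto simp: symmetric_def subdivided_def sym_def)
  then show ?thesis
    using arc finv fina by unfold_locales auto
qed

lemma contains_induced_imp_contains:
  "contains_induced_subgraph G H \<Longrightarrow> contains_subgraph G H"
  unfolding contains_induced_subgraph_def contains_subgraph_def induced_subgraph_def by blast

lemma contains_subgraph_card_le: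
  assumes "pair_graph G" "contains_subgraph G H"
  shows "card (pverts H) \<le> card (pverts G)"
proof -
  interpret pair_graph G by fact
  from assms(2) obtain K f where K: "subgraph (with_proj K) (with_proj G)"
    and f: "pre_digraph.digraph_isomorphism (with_proj H) f" "with_proj K = app_iso f (with_proj H)"
    unfolding contains_subgraph_def digraph_iso_def by blast
  have "inj_on (iso_verts f) (pverts H)"
    using f(1) by (simp add: pre_digraph.digraph_isomorphism_def)
  moreover have "iso_verts f ` pverts H = pverts K"
    using arg_cong[OF f(2), of verts] by (simp add: verts_app_iso)
  moreover have "pverts K \<subseteq> pverts G"
    using K by (simp add: subgraph_def)
  ultimately show ?thesis
    using pair_finite_verts by (metis card_image card_mono)
qed

lemma card_pverts_subdivided:
  assumes "pair_graph F"
  shows "card (pverts F) \<le> card (pverts (subdivided F s))"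
proof -
  interpret pair_graph "subdivided F s" using assms by (rule pair_graph_subdivided)
  have "card (pverts F) = card (Inl ` pverts F :: ('a + ('a \<times> 'a) \<times> nat) set)"
    by (simp add: card_image)
  also have "\<dots> \<le> card (pverts (subdivided F s))"
    by (rule card_mono[OF pair_finite_verts]) (auto simp: subdivided_def)
  finally show ?thesis .
qed

lemma finite_avg_degrees:
  "finite {avg_degree F | F :: nat pair_pre_digraph. simple_graph F \<and> card (pverts F) \<le> n}"
proof (rule finite_subset)
  show "finite ((\<lambda>(a, b). real a / real b) ` ({..n * n} \<times> {..n}))" by simp
  show "{avg_degree F | F :: nat pair_pre_digraph. simple_graph F \<and> card (pverts F) \<le> n}
      \<subseteq> (\<lambda>(a, b). real a / real b) ` ({..n * n} \<times> {..n})"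
  proof (clarify)
    fix F :: "nat pair_pre_digraph"
    assume F: "simple_graph F" "card (pverts F) \<le> n"
    interpret pair_graph F using F(1) by (simp add: simple_graph_def)
    have "parcs F \<subseteq> pverts F \<times> pverts F"
      using arc_fst_in_verts arc_snd_in_verts by force
    then have "card (parcs F) \<le> card (pverts F \<times> pverts F)"
      using pair_finite_verts by (intro card_mono) auto
    also have "\<dots> \<le> n * n"
      using F(2) by (simp add: card_cartesian_product mult_le_mono)
    finally show "avg_degree F \<in> (\<lambda>(a, b). real a / real b) ` ({..n * n} \<times> {..n})"
      using F(2) unfolding avg_degree_def
      by (intro image_eqI[where x = "(card (parcs F), card (pverts F))"]) auto
  qed
qed

lemma contains_induced_single:
  assumes "simple_graph G"
  obtains F :: "nat pair_pre_digraph"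
  where "simple_graph F" "\<And>s. contains_induced_subgraph G (subdivided F s)"
proof -
  interpret G: pair_graph G using assms by (simp add: simple_graph_def)
  obtain v where v: "v \<in> pverts G" using assms by (auto simp: simple_graph_def)
  define F :: "nat pair_pre_digraph" where "F = \<lparr>pverts = {0}, parcs = {}\<rparr>"
  have pF: "pair_graph F" by unfold_locales (auto simp: F_def symmetric_def sym_def)
  have "contains_induced_subgraph G (subdivided F s)" for s
  proof -
    interpret S: pair_graph "subdivided F s" using pF by (rule pair_graph_subdivided)
    define K where "K = \<lparr>pverts = {v}, parcs = {}\<rparr>"
    define f :: "(nat + (nat \<times> nat) \<times> nat, (nat + (nat \<times> nat) \<times> nat) \<times> (nat + (nat \<times> nat) \<times> nat),
                  'a, 'a \<times> 'a) digraph_isomorphism"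
      where "f = \<lparr>iso_verts = \<lambda>_. v, iso_arcs = \<lambda>_. (v, v), iso_head = snd, iso_tail = fst\<rparr>"
    have sub: "pverts (subdivided F s) = {Inl 0}" "parcs (subdivided F s) = {}"
      by (auto simp: subdivided_def sd_arcs_def edge_reps_def F_def)
    have "pair_wf_digraph K" by unfold_locales (auto simp: K_def)
    then interpret K: pair_wf_digraph K .
    have "induced_subgraph (with_proj K) (with_proj G)"
      using v G.wf_digraph K.wf_digraph G.pair_no_loops[of "(v, v)"]
      by (auto simp: induced_subgraph_def subgraph_def compatible_def K_def)
    moreover have "digraph_iso (with_proj (subdivided F s)) (with_proj K)"
      unfolding digraph_iso_def
    proof (intro exI conjI)
      show "pre_digraph.digraph_isomorphism (with_proj (subdivided F s)) f"
        using S.wf_digraph sub by (simp add: pre_digraph.digraph_isomorphism_def)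
      show "with_proj K = app_iso f (with_proj (subdivided F s))"
        using sub by (simp add: app_iso_def f_def K_def with_proj_def)
    qed
    ultimately show ?thesis unfolding contains_induced_subgraph_def by blast
  qed
  moreover have "simple_graph F" using pF by (simp add: simple_graph_def F_def)
  ultimately show ?thesis using that by blast
qed

lemma nabla_le_values:
  fixes G :: "'a pair_pre_digraph" and k :: nat
  assumes "simple_graph G"
  defines "A \<equiv> {avg_degree F | F :: nat pair_pre_digraph.
     simple_graph F \<and> (\<exists>H \<in> le_subdivisions k F. contains_induced_subgraph G H)}"
  shows "finite A" "A \<noteq> {}"
proof -
  have "card (pverts F) \<le> card (pverts G)"
    if F: "simple_graph F" "H \<in> le_subdivisions k F" "contains_induced_subgraph G H"
    for F :: "nat pair_pre_digraph" and H
  proof -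
    obtain s where "H = subdivided F s"
      using F(2) unfolding le_subdivisions_def by blast
    then have "card (pverts F) \<le> card (pverts H)"
      using F(1) by (simp add: simple_graph_def card_pverts_subdivided)
    also have "\<dots> \<le> card (pverts G)"
      using assms(1) contains_induced_imp_contains[OF F(3)]
      by (intro contains_subgraph_card_le) (simp_all add: simple_graph_def)
    finally show ?thesis .
  qed
  then have "A \<subseteq> {avg_degree F | F :: nat pair_pre_digraph.
      simple_graph F \<and> card (pverts F) \<le> card (pverts G)}"
    unfolding A_def by blast
  then show "finite A" using finite_avg_degrees by (rule finite_subset)
  obtain F :: "nat pair_pre_digraph" where F: "simple_graph F"
    "\<And>s. contains_induced_subgraph G (subdivided F s)"
    using contains_induced_single[OF assms(1)] by blast
  have "subdivided F (\<lambda>_. 0) \<in> le_subdivisions k F"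
    unfolding le_subdivisions_def by (intro CollectI exI[of _ "\<lambda>_. 0"]) simp
  then show "A \<noteq> {}" unfolding A_def using F by blast
qed

lemma nabla_eq_values:
  fixes G :: "'a pair_pre_digraph" and k :: nat
  assumes "simple_graph G"
  defines "A \<equiv> {avg_degree F | F :: nat pair_pre_digraph.
     simple_graph F \<and> contains_induced_subgraph G (k_subdivision k F)}"
  shows "finite A" "A \<noteq> {}"
proof -
  have "k_subdivision k F \<in> le_subdivisions k F" for F :: "nat pair_pre_digraph"
    unfolding le_subdivisions_def k_subdivision_def by (intro CollectI exI[of _ "\<lambda>_. k"]) simp
  then have "A \<subseteq> {avg_degree F | F :: nat pair_pre_digraph.
     simple_graph F \<and> (\<exists>H \<in> le_subdivisions k F. contains_induced_subgraph G H)}"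
    unfolding A_def by blast
  then show "finite A" using nabla_le_values(1)[OF assms(1)] by (rule finite_subset)
  obtain F :: "nat pair_pre_digraph" where "simple_graph F"
    "\<And>s. contains_induced_subgraph G (subdivided F s)"
    using contains_induced_single[OF assms(1)] by blast
  then show "A \<noteq> {}" unfolding A_def k_subdivision_def by blast
qed

end

theory Submission
  imports Defs "HOL-Library.Ramsey"
begin

text \<open>
  If the \<open>\<le>k\<close>-subdivision of a graph on at most \<open>n\<close> vertices with average degree \<open>n\<^sup>\<epsilon>\<close> embeds into
  \<open>G\<close>, take a small set \<open>A\<close> in which most vertices have many neighbours and let each of these vertices
  subdivide an edge between two vertices of \<open>A\<close>. Up to constants this keeps the average degree and
  divides the number of vertices by it, while path lengths only double. After about \<open>2/\<epsilon>\<close> rounds, a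
  number not depending on \<open>t\<close>, there would be fewer vertices than the average degree, unless some round
  met a clique of order \<open>t\<close>.

  Conversely, a \<open>\<le>k\<close>-subdivision of \<open>K\<^sub>t\<close> spans an induced subgraph of \<open>G\<close> with at most
  \<open>(k + 1) t\<^sup>2\<close> vertices. If the parameters in (c) are at most \<open>D\<close> for it, then (using them with
  \<open>k = 0\<close>) all its induced subgraphs have average degree at most \<open>D\<close>, so independent sets and random
  choices turn the subdivision into an induced exact one of a graph with about \<open>t\<^sup>2\<close> edges, up to
  powers of \<open>D\<close>. Hence \<open>t\<close> is at most polynomial in \<open>D\<close>, which fails if \<open>D\<close> is a small power of \<open>t\<close>.
\<close>

section \<open>Walks through a set of vertices\<close>

text \<open>The order of quantifiers shapes (a) to (b): the clique order to be excluded is given by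
  \<open>h\<close> at the subdivision length reached after the last round, so the number of rounds
  has to be settled from \<open>\<epsilon>\<close> alone, before \<open>t\<close> is known. Each
  round divides the degree by \<open>32 * t\<close>, but the initial degree is a power of
  \<open>n\<close>, which absorbs every such constant once \<open>n\<close> is large.

  In (c) to (a) the exponents decide. The order bound has the form t \<le> 18 D^5 (k + 1)^4, and the
  induced subgraph has N vertices with t \<le> N \<le> (k + 1) t^2. The lower bound on N brings the
  asymptotic estimate of \<open>f\<close> into force; the upper bound makes D = N^(1/20) give D^5 =
  N^(1/4) \<le> (k + 1) sqrt t, so t would be at most a constant times sqrt t.

  Paths are stored as sets of inner vertices. Sizes and disjointness are then easy to track while
  paths are joined, and the order along a path is recovered only when a subdivision has to be
  exhibited.\<close>

definition walk_via :: "'b rel \<Rightarrow> 'b set \<Rightarrow> (nat \<Rightarrow> 'b) \<Rightarrow> nat \<Rightarrow> bool" where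
  "walk_via E S p l \<longleftrightarrow> (\<forall>i<l. (p i, p (Suc i)) \<in> E) \<and> (\<forall>i. 0 < i \<and> i < l \<longrightarrow> p i \<in> S)"

text \<open>The length is not recorded: the size of \<open>S\<close> bounds the number of inner
  vertices of an induced path extracted later. Walks, unlike paths, can be joined and reversed
  without any disjointness condition.\<close>

definition linked :: "'b rel \<Rightarrow> 'b set \<Rightarrow> 'b \<Rightarrow> 'b \<Rightarrow> bool" where
  "linked E S u v \<longleftrightarrow> (\<exists>p l. walk_via E S p l \<and> p 0 = u \<and> p l = v)"

lemma linked_arc: "(u, v) \<in> E \<Longrightarrow> linked E S u v"
  unfolding linked_def walk_via_def
  by (intro exI[of _ "\<lambda>i. if i = 0 then u else v"] exI[of _ 1]) auto

text \<open>The junction \<open>v\<close> turns into an inner vertex and therefore enters the set.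
  In a densification round it is the old branch vertex in the middle of a new path, which accounts
  for the 1 in \<open>2 * L + 1\<close>.\<close>

lemma linked_trans:
  assumes "linked E S u v" "linked E T v w"
  shows "linked E (insert v (S \<union> T)) u w"
proof -
  obtain p l where p: "walk_via E S p l" "p 0 = u" "p l = v"
    using assms(1) unfolding linked_def by blast
  obtain q m where q: "walk_via E T q m" "q 0 = v" "q m = w"
    using assms(2) unfolding linked_def by blast
  define r where "r = (\<lambda>i. if i \<le> l then p i else q (i - l))"
  have pE: "(p i, p (Suc i)) \<in> E" if "i < l" for i using p(1) that by (simp add: walk_via_def)
  have qE: "(q i, q (Suc i)) \<in> E" if "i < m" for i using q(1) that by (simp add: walk_via_def)
  have pS: "p i \<in> S" if "0 < i" "i < l" for i using p(1) that by (simp add: walk_via_def)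
  have qT: "q i \<in> T" if "0 < i" "i < m" for i using q(1) that by (simp add: walk_via_def)
  have "walk_via E (insert v (S \<union> T)) r (l + m)"
    unfolding walk_via_def
  proof (intro conjI allI impI)
    fix i assume i: "i < l + m"
    consider "i < l" | "i = l" | "i > l" by linarith
    then show "(r i, r (Suc i)) \<in> E"
    proof cases
      case 1 then show ?thesis using pE[of i] by (simp add: r_def)
    next
      case 2 then show ?thesis using qE[of 0] p(3) q(2) i by (simp add: r_def)
    next
      case 3 then show ?thesis using qE[of "i - l"] i by (simp add: r_def Suc_diff_le)
    qed
  next
    fix i assume i: "0 < i \<and> i < l + m"
    consider "i < l" | "i = l" | "i > l" by linarith
    then show "r i \<in> insert v (S \<union> T)"
    proof cases
      case 1 then show ?thesis using pS[of i] i by (simp add: r_def)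
    next
      case 2 then show ?thesis using p(3) by (simp add: r_def)
    next
      case 3 then show ?thesis using qT[of "i - l"] i by (simp add: r_def)
    qed
  qed
  moreover have "r 0 = u" "r (l + m) = w" using p q by (auto simp: r_def)
  ultimately show ?thesis unfolding linked_def by blast
qed

lemma linked_sym:
  assumes "sym E" "linked E S u v"
  shows "linked E S v u"
proof -
  obtain p l where p: "walk_via E S p l" "p 0 = u" "p l = v"
    using assms(2) unfolding linked_def by blast
  have "walk_via E S (\<lambda>i. p (l - i)) l"
    unfolding walk_via_def
  proof (intro conjI allI impI)
    fix i assume "i < l"
    then have "(p (l - Suc i), p (Suc (l - Suc i))) \<in> E" "Suc (l - Suc i) = l - i"
      using p(1) by (auto simp: walk_via_def)
    then show "(p (l - i), p (l - Suc i)) \<in> E" using assms(1) by (metis symD)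
  next
    fix i assume "0 < i \<and> i < l"
    then show "p (l - i) \<in> S" using p(1) by (auto simp: walk_via_def)
  qed
  then show ?thesis using p(2,3) unfolding linked_def
    by (intro exI[of _ "\<lambda>i. p (l - i)"] exI[of _ l]) auto
qed

lemma walk_via_shortcut:
  assumes "walk_via E S p l" "i < j" "j \<le> l" "(p i, p j) \<in> E"
  shows "\<exists>q. walk_via E S q (l - (j - Suc i)) \<and> q 0 = p 0 \<and> q (l - (j - Suc i)) = p l"
proof (intro exI conjI)
  let ?q = "\<lambda>m. if m \<le> i then p m else p (m + (j - Suc i))"
  show "walk_via E S ?q (l - (j - Suc i))"
    unfolding walk_via_def
  proof (intro conjI allI impI)
    fix m assume m: "m < l - (j - Suc i)"
    consider "m < i" | "m = i" | "m > i" by linarith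
    then show "(?q m, ?q (Suc m)) \<in> E"
      using assms m by cases (auto simp: walk_via_def)
  next
    fix m assume "0 < m \<and> m < l - (j - Suc i)"
    then show "?q m \<in> S" using assms by (auto simp: walk_via_def)
  qed
  show "?q (l - (j - Suc i)) = p l" using assms by auto
qed simp

text \<open>A walk of least length has no forward chord, since a chord would shorten it. A repeated
  vertex would have a chord to the successor of its later occurrence; at the last position there is
  no successor, and there \<open>u \<noteq> v\<close> and \<open>v \<notin> S\<close> exclude the
  repetition.\<close>

lemma linked_imp_induced_path:
  assumes "linked E S u v" "u \<noteq> v" "v \<notin> S"
  obtains p l where "walk_via E S p l" "p 0 = u" "p l = v" "inj_on p {..l}"
    "\<And>i j. i < j \<Longrightarrow> j \<le> l \<Longrightarrow> (p i, p j) \<in> E \<Longrightarrow> j = Suc i"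
proof -
  define P where "P = (\<lambda>l. \<exists>p. walk_via E S p l \<and> p 0 = u \<and> p l = v)"
  define l where "l = (LEAST l. P l)"
  have "\<exists>l. P l" using assms(1) unfolding linked_def P_def by blast
  then have "P l" unfolding l_def by (rule LeastI_ex)
  then obtain p where p: "walk_via E S p l" "p 0 = u" "p l = v" unfolding P_def by blast
  have chord: "j = Suc i" if "i < j" "j \<le> l" "(p i, p j) \<in> E" for i j
  proof -
    have "P (l - (j - Suc i))"
      using walk_via_shortcut[OF p(1) that] p unfolding P_def by auto
    then have "l \<le> l - (j - Suc i)" unfolding l_def by (rule Least_le)
    then show ?thesis using that by linarith
  qed
  have neq: "p i \<noteq> p j" if "i < j" "j \<le> l" for i j
  proof
    assume eq: "p i = p j"
    show False
    proof (cases "j = l")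
      case True
      then have "i \<noteq> 0" using eq p assms(2) by metis
      then have "p i \<in> S" using p(1) that True by (auto simp: walk_via_def)
      then show False using eq True p(3) assms(3) by simp
    next
      case False
      then have "(p i, p (Suc j)) \<in> E" using eq p(1) that by (auto simp: walk_via_def)
      then have "Suc j = Suc i" using chord[of i "Suc j"] that False by auto
      then show False using that by simp
    qed
  qed
  have "inj_on p {..l}"
    by (rule linorder_inj_onI) (auto dest: neq)
  then show ?thesis using that p chord by blast
qed

lemma linked_restrict:
  assumes "linked E S u v" "S \<subseteq> Y" "u \<in> Y" "v \<in> Y"
  shows "linked (E \<inter> Y \<times> Y) S u v"
proof -
  obtain p l where p: "walk_via E S p l" "p 0 = u" "p l = v"
    using assms(1) unfolding linked_def by blast
  have "p i \<in> Y" if "i \<le> l" for i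
    using p assms that by (cases "i = 0"; cases "i = l") (auto simp: walk_via_def)
  then have "walk_via (E \<inter> Y \<times> Y) S p l" using p(1) by (auto simp: walk_via_def)
  then show ?thesis using p unfolding linked_def by blast
qed

lemma linked_empty:
  assumes "linked E {} u v" "u \<noteq> v"
  shows "(u, v) \<in> E"
proof -
  obtain p l where p: "walk_via E {} p l" "p 0 = u" "p l = v"
    using assms(1) unfolding linked_def by blast
  have "l \<noteq> 0" using p assms(2) by metis
  moreover have "\<not> 1 < l" using p(1) unfolding walk_via_def by fastforce
  ultimately have "l = 1" by simp
  then show ?thesis using p by (auto simp: walk_via_def)
qed

section \<open>Topological models\<close>

text \<open>
  The branch vertices are vertices of the host graph. An edge \<open>e\<close> of the modelled graph comes with a
  vertex set \<open>I e\<close> containing an inner walk instead of a path, so that no orientation is chosen.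
\<close>

definition topological_model ::
  "'b rel \<Rightarrow> 'b set \<Rightarrow> 'b set set \<Rightarrow> ('b set \<Rightarrow> 'b set) \<Rightarrow> nat \<Rightarrow> bool" where
  "topological_model E W R I L \<longleftrightarrow> finite W \<and> R \<subseteq> nsets W 2 \<and>
     (\<forall>u v. {u, v} \<in> R \<longrightarrow> linked E (I {u, v}) u v) \<and>
     (\<forall>e \<in> R. finite (I e) \<and> card (I e) \<le> L \<and> I e \<inter> W = {}) \<and> disjoint_family_on I R"

lemma topological_modelD:
  assumes "topological_model E W R I L"
  shows "finite W" "R \<subseteq> nsets W 2" "finite R"
    "\<And>u v. {u, v} \<in> R \<Longrightarrow> linked E (I {u, v}) u v"
    "\<And>u v. {u, v} \<in> R \<Longrightarrow> u \<in> W \<and> v \<in> W \<and> u \<noteq> v"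
    "\<And>e. e \<in> R \<Longrightarrow> finite (I e)" "\<And>e. e \<in> R \<Longrightarrow> card (I e) \<le> L"
    "\<And>e x. e \<in> R \<Longrightarrow> x \<in> I e \<Longrightarrow> x \<notin> W" "disjoint_family_on I R"
    "\<And>e f x. e \<in> R \<Longrightarrow> f \<in> R \<Longrightarrow> x \<in> I e \<Longrightarrow> x \<in> I f \<Longrightarrow> e = f"
proof -
  show *: "finite W" "R \<subseteq> nsets W 2" "disjoint_family_on I R"
    using assms unfolding topological_model_def by blast+
  then show "finite R" by (meson finite_imp_finite_nsets finite_subset)
  show "u \<in> W \<and> v \<in> W \<and> u \<noteq> v" if "{u, v} \<in> R" for u v
    using *(2) that by (metis doubleton_in_nsets_2 subsetD)
  show "e = f" if "e \<in> R" "f \<in> R" "x \<in> I e" "x \<in> I f" for e f x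
    using *(3) that unfolding disjoint_family_on_def by blast
qed (use assms in \<open>auto simp: topological_model_def\<close>)

lemma topological_model_mono:
  assumes "topological_model E W R I L" "X \<subseteq> W" "Q \<subseteq> R" "Q \<subseteq> nsets X 2" "L \<le> M"
  shows "topological_model E X Q I M"
proof -
  note m = topological_modelD[OF assms(1)]
  have "finite X" using assms(2) m(1) by (rule finite_subset)
  moreover have "disjoint_family_on I Q" using assms(3) m(9) by (rule disjoint_family_on_mono)
  moreover have "finite (I e) \<and> card (I e) \<le> M \<and> I e \<inter> X = {}" if "e \<in> Q" for e
    using m(6-8)[of e] that assms(2,3,5) by fastforce
  ultimately show ?thesis
    using assms(3,4) m(4) unfolding topological_model_def by auto
qed

section \<open>Clique models in dense graphs\<close>

lemma finite_argmax:
  fixes f :: "'b \<Rightarrow> real"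
  assumes "finite S" "S \<noteq> {}"
  shows "\<exists>x\<in>S. \<forall>y\<in>S. f y \<le> f x"
proof -
  have "Max (f ` S) \<in> f ` S" using assms by (intro Max_in) auto
  then obtain x where "x \<in> S" "f x = Max (f ` S)" by force
  then show ?thesis using assms by (intro bexI[of _ x]) auto
qed

text \<open>Maximise the number of edges minus \<open>\<delta> / 4\<close> per vertex: deleting a
  vertex does not raise this value, so every degree is at least \<open>\<delta> / 4\<close>. The
  value of \<open>W\<close> itself is at least \<open>\<delta> / 4 * card W\<close>, hence positive,
  which keeps the maximiser nonempty; charging \<open>\<delta> / 2\<close> would leave no such
  slack.\<close>

lemma min_degree_subgraph:
  fixes W :: "'b set" and \<delta> :: real
  assumes "finite W" "W \<noteq> {}" "R \<subseteq> nsets W 2" "0 < \<delta>" "\<delta> * card W \<le> 2 * card R"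
  obtains X where "X \<subseteq> W" "X \<noteq> {}"
    "\<And>v. v \<in> X \<Longrightarrow> \<delta> / 4 \<le> card {w. {v, w} \<in> R \<inter> nsets X 2}"
proof -
  define \<Psi> where "\<Psi> = (\<lambda>X. real (card (R \<inter> nsets X 2)) - \<delta> / 4 * card X)"
  have "\<exists>X\<in>Pow W. \<forall>Y\<in>Pow W. \<Psi> Y \<le> \<Psi> X"
    using assms(1) by (intro finite_argmax) auto
  then obtain X where X: "X \<subseteq> W" "\<And>Y. Y \<subseteq> W \<Longrightarrow> \<Psi> Y \<le> \<Psi> X" by blast
  have cW: "card W > 0" using assms by auto
  have "\<Psi> W > 0"
  proof -
    have "0 < \<delta> * card W" using cW assms(4) by simp
    moreover have "R \<inter> nsets W 2 = R" using assms(3) by blast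
    ultimately show ?thesis using assms(5) unfolding \<Psi>_def by simp
  qed
  moreover have "\<Psi> {} = 0" by (auto simp: \<Psi>_def nsets_def)
  ultimately have "X \<noteq> {}" using X(2)[of W] by auto
  moreover have "\<delta> / 4 \<le> card {w. {v, w} \<in> R \<inter> nsets X 2}" if v: "v \<in> X" for v
  proof -
    let ?N = "{w. {v, w} \<in> R \<inter> nsets X 2}"
    have finX: "finite X" using X(1) assms(1) finite_subset by blast
    have finN: "finite ?N" by (rule finite_subset[OF _ finX]) auto
    have fin: "finite (R \<inter> nsets (X - {v}) 2)" using finX by (simp add: finite_imp_finite_nsets)
    have "R \<inter> nsets X 2 \<subseteq> R \<inter> nsets (X - {v}) 2 \<union> (\<lambda>w. {v, w}) ` ?N"
    proof
      fix e assume e: "e \<in> R \<inter> nsets X 2"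
      then obtain a b where ab: "e = {a, b}" "a \<in> X" "b \<in> X" "a \<noteq> b"
        unfolding nsets_2_eq by blast
      show "e \<in> R \<inter> nsets (X - {v}) 2 \<union> (\<lambda>w. {v, w}) ` ?N"
      proof (cases "v \<in> e")
        case True
        then obtain w where "e = {v, w}" using ab by blast
        then show ?thesis using e by blast
      next
        case False
        then have "e \<in> nsets (X - {v}) 2" using ab by auto
        then show ?thesis using e by blast
      qed
    qed
    then have "card (R \<inter> nsets X 2) \<le> card (R \<inter> nsets (X - {v}) 2 \<union> (\<lambda>w. {v, w}) ` ?N)"
      using fin finN by (intro card_mono) auto
    also have "\<dots> \<le> card (R \<inter> nsets (X - {v}) 2) + card ((\<lambda>w. {v, w}) ` ?N)"
      by (rule card_Un_le)
    also have "\<dots> \<le> card (R \<inter> nsets (X - {v}) 2) + card ?N"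
      using card_image_le[OF finN] by simp
    finally have 1: "card (R \<inter> nsets X 2) \<le> card (R \<inter> nsets (X - {v}) 2) + card ?N" .
    have 2: "\<Psi> (X - {v}) \<le> \<Psi> X" using X by blast
    have "real (card X) = real (card (X - {v})) + 1"
      using v finX by (metis Suc_eq_plus1 card_Suc_Diff1 of_nat_1 of_nat_add)
    then show ?thesis using 1 2 unfolding \<Psi>_def by (simp add: algebra_simps)
  qed
  ultimately show ?thesis using that X(1) by blast
qed

text \<open>
  A maximiser \<open>A\<close> of \<open>(\<Sum>v. min t \<bar>N v \<inter> A\<bar>) - \<bar>A\<bar> (d - t) / 2\<close> works: no vertex outside \<open>A\<close> has more
  than \<open>(d - t) / 2\<close> unsaturated neighbours, and \<open>A\<close> is not worse than the empty set.
\<close>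

lemma small_dominating_set:
  fixes V :: "'b set" and d :: real
  assumes "finite V" "1 \<le> t" "2 * real t \<le> d"
    and N: "\<And>v. v \<in> V \<Longrightarrow> N v \<subseteq> V \<and> d \<le> card (N v)"
  obtains A where "A \<subseteq> V" "card A * d \<le> 4 * t * card V"
    "2 * card {v \<in> V. card (N v \<inter> A) < t} \<le> card V"
proof -
  define \<Psi> where "\<Psi> = (\<lambda>A. real (\<Sum>v\<in>V. min t (card (N v \<inter> A))) - card A * ((d - t) / 2))"
  have "\<exists>X\<in>Pow V. \<forall>Y\<in>Pow V. \<Psi> Y \<le> \<Psi> X"
    using assms(1) by (intro finite_argmax) auto
  then obtain A where A: "A \<subseteq> V" "\<And>Y. Y \<subseteq> V \<Longrightarrow> \<Psi> Y \<le> \<Psi> A" by blast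
  have finA: "finite A" using A(1) assms(1) finite_subset by blast
  have dt: "d - t \<ge> d / 2" "d > 0" using assms by auto
  have "\<Psi> {} = 0" by (simp add: \<Psi>_def)
  then have "card A * ((d - t) / 2) \<le> real (\<Sum>v\<in>V. min t (card (N v \<inter> A)))"
    using A(2)[of "{}"] unfolding \<Psi>_def by simp
  also have "\<dots> \<le> real (\<Sum>v\<in>V. t)" by (intro of_nat_mono sum_mono) simp
  finally have "card A * (d - t) \<le> 2 * t * card V" by (simp add: algebra_simps)
  moreover have "card A * (d / 2) \<le> card A * (d - t)" using dt by (intro mult_left_mono) auto
  ultimately have sizeA: "card A * d \<le> 4 * t * card V" by simp
  define U where "U = {v \<in> V. card (N v \<inter> A) < t}"
  have finU: "finite U" using assms(1) by (simp add: U_def)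
  have gain: "real (card {v \<in> U. x \<in> N v}) \<le> (d - t) / 2" if x: "x \<in> V - A" for x
  proof -
    have "min t (card (N v \<inter> insert x A)) = min t (card (N v \<inter> A)) + (if v \<in> U \<and> x \<in> N v then 1 else 0)"
      if "v \<in> V" for v
    proof (cases "x \<in> N v")
      case True
      then have "N v \<inter> insert x A = insert x (N v \<inter> A)" by blast
      moreover have "x \<notin> N v \<inter> A" "finite (N v \<inter> A)" using x finA by auto
      ultimately have "card (N v \<inter> insert x A) = Suc (card (N v \<inter> A))" by simp
      then show ?thesis using that True by (auto simp: U_def)
    next
      case False
      then have "N v \<inter> insert x A = N v \<inter> A" by blast
      then show ?thesis using False by simp
    qed
    then have "(\<Sum>v\<in>V. min t (card (N v \<inter> insert x A)))
        = (\<Sum>v\<in>V. min t (card (N v \<inter> A)) + (if v \<in> U \<and> x \<in> N v then 1 else 0))"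
      by (intro sum.cong) auto
    also have "\<dots> = (\<Sum>v\<in>V. min t (card (N v \<inter> A))) + card {v \<in> V. v \<in> U \<and> x \<in> N v}"
      using assms(1) by (simp add: sum.distrib sum.If_cases Int_def)
    also have "{v \<in> V. v \<in> U \<and> x \<in> N v} = {v \<in> U. x \<in> N v}" by (auto simp: U_def)
    finally have "\<Psi> (insert x A) = \<Psi> A + card {v \<in> U. x \<in> N v} - (d - t) / 2"
      using x finA unfolding \<Psi>_def by (simp add: distrib_right add_divide_distrib)
    then show ?thesis using A(2)[of "insert x A"] x A(1) by auto
  qed
  \<comment> \<open>Double counting of the pairs of an unsaturated \<open>v\<close> and a member
    \<open>x\<close> of \<open>N v - A\<close>: every \<open>v\<close> lies in at least
    \<open>d - t\<close> of them, and by \<open>gain\<close> every \<open>x\<close> in at most half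
    as many. So at most half of \<open>V\<close> is unsaturated.\<close>
  have "real (card U) * (d - t) = (\<Sum>v\<in>U. d - t)" by simp
  also have "\<dots> \<le> (\<Sum>v\<in>U. real (card (N v - A)))"
  proof (rule sum_mono)
    fix v assume v: "v \<in> U"
    then have "finite (N v)" using N[of v] assms(1) by (auto simp: U_def intro: finite_subset)
    then have "card (N v) = card (N v \<inter> A) + card (N v - A)"
      by (metis card_Int_Diff)
    then show "d - t \<le> real (card (N v - A))" using N[of v] v by (auto simp: U_def)
  qed
  also have "\<dots> = (\<Sum>v\<in>U. \<Sum>x\<in>V - A. if x \<in> N v then 1 else 0)"
  proof (rule sum.cong)
    fix v assume v: "v \<in> U"
    have "N v - A = {x \<in> V - A. x \<in> N v}" using N v by (auto simp: U_def)
    then show "real (card (N v - A)) = (\<Sum>x\<in>V - A. if x \<in> N v then 1 else 0)"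
      using assms(1) by (simp add: sum.If_cases Int_def)
  qed simp
  also have "\<dots> = (\<Sum>x\<in>V - A. \<Sum>v\<in>U. if x \<in> N v then 1 else 0)" by (rule sum.swap)
  also have "\<dots> = (\<Sum>x\<in>V - A. real (card {v \<in> U. x \<in> N v}))"
    using finU by (simp add: sum.If_cases Int_def)
  also have "\<dots> \<le> (\<Sum>x\<in>V - A. (d - t) / 2)" by (intro sum_mono gain)
  also have "\<dots> \<le> card V * ((d - t) / 2)"
    using card_mono[of V "V - A"] assms(1) dt by (simp add: mult_right_mono)
  finally have "real (card U) * (d - t) \<le> card V / 2 * (d - t)" by simp
  then have "real (card U) \<le> card V / 2" using dt by simp
  then show ?thesis using that[OF A(1) sizeA] unfolding U_def by linarith
qed

text \<open>
  Every vertex with \<open>t\<close> neighbours in a small set \<open>A\<close> is made the middle vertex of a path joining two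
  of them, greedily with distinct pairs. A vertex left over sees \<open>t\<close> vertices of \<open>A\<close> which are already
  pairwise joined.
\<close>

lemma densify:
  fixes d :: real
  assumes m: "topological_model E W R I L" and W: "W \<noteq> {}" and t: "1 \<le> t" "32 * real t \<le> d"
    and deg: "\<And>v. v \<in> W \<Longrightarrow> d \<le> card {w. {v, w} \<in> R}"
  shows "(\<exists>T J. card T = t \<and> topological_model E T (nsets T 2) J (2 * L + 1)) \<or>
    (\<exists>X Q J. topological_model E X Q J (2 * L + 1) \<and> X \<noteq> {} \<and> card X * d \<le> 4 * t * card W \<and>
      (\<forall>v\<in>X. d / (32 * t) \<le> card {w. {v, w} \<in> Q}))"
proof -
  note mD = topological_modelD[OF m]
  define N where "N = (\<lambda>v. {w. {v, w} \<in> R})"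
  have "N v \<subseteq> W \<and> d \<le> card (N v)" if "v \<in> W" for v
    using deg[OF that] mD(5) unfolding N_def by blast
  then obtain A where A: "A \<subseteq> W" "card A * d \<le> 4 * t * card W"
    "2 * card {v \<in> W. card (N v \<inter> A) < t} \<le> card W"
    using small_dominating_set[of W t d N] mD(1) t by auto
  have finA: "finite A" using A(1) mD(1) by (rule finite_subset)
  have dpos: "d > 0" using t by linarith
  define U where "U = {v \<in> W. card (N v \<inter> A) < t}"
  define Z where "Z = W - A - U"
  have cW: "card W > 0" using W mD(1) by auto
  \<comment> \<open>From \<open>32 * t \<le> d\<close> the set \<open>A\<close> has at most an
    eighth of the vertices of \<open>W\<close>, and \<open>U\<close> at most half, so more than a
    quarter remains for \<open>Z\<close>.\<close>
  have cZ: "card W \<le> 4 * real (card Z)"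
  proof -
    have "card A * (32 * real t) \<le> card A * d" using t by (intro mult_left_mono) auto
    then have "8 * card A * real t \<le> card W * real t" using A(2) by (simp add: algebra_simps)
    then have "8 * real (card A) \<le> card W" using t by simp
    moreover have "card W \<le> card (Z \<union> A \<union> U)"
      using mD(1) finA by (intro card_mono) (auto simp: Z_def U_def)
    moreover have "card (Z \<union> A \<union> U) \<le> card Z + card A + card U"
      by (meson card_Un_le le_trans add_le_mono1)
    moreover have "2 * card U \<le> card W" using A(3) by (simp add: U_def)
    ultimately show ?thesis by linarith
  qed
  have finZ: "finite Z" using mD(1) by (simp add: Z_def)
  define \<Z> where "\<Z> = {Y \<in> Pow Z. \<exists>\<mu>. inj_on \<mu> Y \<and> (\<forall>z\<in>Y. \<mu> z \<in> nsets (N z \<inter> A) 2)}"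
  have "finite \<Z>" "{} \<in> \<Z>" using finZ by (auto simp: \<Z>_def)
  then obtain Y where Y: "Y \<in> \<Z>" "\<And>Y'. Y' \<in> \<Z> \<Longrightarrow> Y \<subseteq> Y' \<Longrightarrow> Y = Y'"
    using finite_has_maximal[of \<Z>] by blast
  then obtain \<mu> where \<mu>: "inj_on \<mu> Y" "\<And>z. z \<in> Y \<Longrightarrow> \<mu> z \<in> nsets (N z \<inter> A) 2"
    and YZ: "Y \<subseteq> Z" unfolding \<Z>_def by blast
  define Q where "Q = \<mu> ` Y"
  define z where "z = the_inv_into Y \<mu>"
  define J where "J = (\<lambda>e. insert (z e) (\<Union>a\<in>e. I {z e, a}))"
  have z: "z e \<in> Y" "z e \<in> W" "z e \<notin> A" "\<mu> (z e) = e" "e \<in> nsets (N (z e) \<inter> A) 2"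
    if "e \<in> Q" for e
  proof -
    show *: "z e \<in> Y" "\<mu> (z e) = e"
      using that \<mu>(1) unfolding z_def Q_def
      by (auto simp: the_inv_into_into f_the_inv_into_f intro!: the_inv_into_into[OF \<mu>(1)])
    then show "e \<in> nsets (N (z e) \<inter> A) 2" using \<mu>(2)[of "z e"] by simp
    show "z e \<in> W" "z e \<notin> A" using * YZ by (auto simp: Z_def)
  qed
  have zR: "{z e, a} \<in> R" "a \<in> A" if "e \<in> Q" "a \<in> e" for e a
    using z(5)[OF that(1)] that(2) by (auto simp: nsets_def N_def)
  have model: "topological_model E A Q J (2 * L + 1)"
    unfolding topological_model_def
  proof (intro conjI allI impI ballI)
    show "finite A" by fact
    show "Q \<subseteq> nsets A 2" using z(5) by (auto simp: nsets_def)
    show "linked E (J {u, v}) u v" if e: "{u, v} \<in> Q" for u v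
    proof -
      let ?z = "z {u, v}"
      have "{u, ?z} \<in> R" "{?z, v} \<in> R" using zR(1)[OF e, of u] zR(1)[OF e, of v] by (simp_all add: insert_commute)
      then have "linked E (I {u, ?z}) u ?z" "linked E (I {?z, v}) ?z v" using mD(4) by auto
      from linked_trans[OF this] show ?thesis by (simp add: J_def insert_commute)
    qed
    fix e assume e: "e \<in> Q"
    have fe: "finite e" "card e = 2" using z(5)[OF e] by (auto simp: nsets_def)
    show "finite (J e)" using fe mD(6) zR(1)[OF e] by (auto simp: J_def)
    have "card (J e) \<le> Suc (card (\<Union>a\<in>e. I {z e, a}))"
      unfolding J_def by (rule card_insert_le_m1) auto
    also have "card (\<Union>a\<in>e. I {z e, a}) \<le> (\<Sum>a\<in>e. card (I {z e, a}))"
      using fe(1) by (rule card_UN_le)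
    also have "\<dots> \<le> (\<Sum>a\<in>e. L)" using mD(7) zR(1)[OF e] by (intro sum_mono) auto
    also have "\<dots> = 2 * L" using fe by simp
    finally show "card (J e) \<le> 2 * L + 1" by simp
    show "J e \<inter> A = {}"
      using z(3)[OF e] mD(8) zR(1)[OF e] A(1) by (auto simp: J_def)
  next
    show "disjoint_family_on J Q"
      unfolding disjoint_family_on_def
    proof (intro ballI impI)
      fix e f assume ef: "e \<in> Q" "f \<in> Q" "e \<noteq> f"
      have zz: "z e \<noteq> z f" using z(4) ef by metis
      \<comment> \<open>The two old edges have different middle vertices, and \<open>z e\<close>
        lies outside \<open>A\<close> while \<open>b\<close> lies in it. Distinct old edges have
        disjoint inner sets.\<close>
      have "{z e, a} \<noteq> {z f, b}" if "a \<in> e" "b \<in> f" for a b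
        using zz zR(2)[OF ef(2) that(2)] z(3)[OF ef(1)] by (auto simp: doubleton_eq_iff)
      then have "I {z e, a} \<inter> I {z f, b} = {}" if "a \<in> e" "b \<in> f" for a b
        using mD(10) zR(1) ef that by blast
      moreover have "z e \<notin> I {z f, b}" if "b \<in> f" for b
        using mD(8) zR(1)[OF ef(2) that] z(2)[OF ef(1)] by blast
      moreover have "z f \<notin> I {z e, b}" if "b \<in> e" for b
        using mD(8) zR(1)[OF ef(1) that] z(2)[OF ef(2)] by blast
      ultimately show "J e \<inter> J f = {}" using zz unfolding J_def by blast
    qed
  qed
  show ?thesis
  proof (cases "Y = Z")
    case True
    have cQ: "card Q = card Z" unfolding Q_def True[symmetric] by (rule card_image[OF \<mu>(1)])
    have "Z \<noteq> {}" using cZ cW by auto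
    then obtain e where "e \<in> Q" using True by (auto simp: Q_def)
    then have "A \<noteq> {}" using z(5)[of e] by (auto simp: nsets_def)
    \<comment> \<open>The new graph on \<open>A\<close> has at least \<open>card W / 4\<close>
      edges, hence average degree at least \<open>card W / (2 * card A)\<close>, which is at least
      \<open>d / (8 * t)\<close>. Passing to a subgraph of large minimum degree costs another factor
      4, whence \<open>32 * t\<close>.\<close>
    moreover have "d / (8 * t) * card A \<le> 2 * card Q"
    proof -
      have "d / (8 * t) * card A = card A * d / (8 * t)" by simp
      also have "\<dots> \<le> 4 * t * card W / (8 * t)" using A(2) by (intro divide_right_mono) auto
      also have "\<dots> = card W / 2" using t(1) by simp
      also have "\<dots> \<le> 2 * card Q" using cZ cQ by simp
      finally show ?thesis .
    qed
    ultimately obtain X where X: "X \<subseteq> A" "X \<noteq> {}"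
      "\<And>v. v \<in> X \<Longrightarrow> d / (8 * t) / 4 \<le> card {w. {v, w} \<in> Q \<inter> nsets X 2}"
      using min_degree_subgraph[of A Q "d / (8 * t)"] finA topological_modelD(2)[OF model] dpos t(1)
      by auto
    have "topological_model E X (Q \<inter> nsets X 2) J (2 * L + 1)"
      by (rule topological_model_mono[OF model X(1)]) auto
    moreover have "card X * d \<le> 4 * t * card W"
    proof -
      have "card X * d \<le> card A * d"
        using card_mono[OF finA X(1)] dpos by (intro mult_right_mono) auto
      then show ?thesis using A(2) by simp
    qed
    moreover have "d / (32 * real t) \<le> card {w. {v, w} \<in> Q \<inter> nsets X 2}" if "v \<in> X" for v
      using X(3)[OF that] by simp
    ultimately show ?thesis using X(2) by blast
  next
    case False
    then obtain y where y: "y \<in> Z" "y \<notin> Y" using YZ by blast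
    then have "t \<le> card (N y \<inter> A)" by (auto simp: Z_def U_def)
    then obtain T where T: "T \<subseteq> N y \<inter> A" "card T = t" by (meson obtain_subset_with_card_n)
    \<comment> \<open>A pair of \<open>T\<close> outside \<open>Q\<close> could be assigned to
      \<open>y\<close>, contradicting the maximality of \<open>Y\<close>.\<close>
    have "nsets T 2 \<subseteq> Q"
    proof
      fix e assume e: "e \<in> nsets T 2"
      show "e \<in> Q"
      proof (rule ccontr)
        assume "e \<notin> Q"
        then have "inj_on (\<mu>(y := e)) (insert y Y)"
          using \<mu>(1) y(2) by (auto simp: inj_on_def Q_def)
        moreover have "(\<mu>(y := e)) x \<in> nsets (N x \<inter> A) 2" if "x \<in> insert y Y" for x
          using that \<mu>(2) e T(1) by (auto simp: nsets_def)
        ultimately have "insert y Y \<in> \<Z>" using y(1) YZ unfolding \<Z>_def by blast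
        then show False using Y(2)[of "insert y Y"] y(2) by blast
      qed
    qed
    then have "topological_model E T (nsets T 2) J (2 * L + 1)"
      using T(1) by (intro topological_model_mono[OF model]) auto
    then show ?thesis using T(2) by blast
  qed
qed

text \<open>With \<open>c = 32 * t\<close>, a round that starts at degree \<open>d / c ^ i\<close>
  shrinks the vertex set by a factor of at most \<open>c ^ Suc i / d\<close>. The exponents 1 + 2 +
  ... + i of \<open>c\<close> add up to at most \<open>i * i\<close>. The quantity
  \<open>L + 1\<close> doubles in each round.\<close>

lemma densify_iterate:
  fixes d :: real
  assumes "topological_model E W R I L" "W \<noteq> {}" "1 \<le> t" "(32 * real t) ^ i \<le> d"
    and "\<And>v. v \<in> W \<Longrightarrow> d \<le> card {w. {v, w} \<in> R}"
    and "\<And>T J. card T = t \<Longrightarrow> \<not> topological_model E T (nsets T 2) J (2 ^ i * (L + 1) - 1)"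
  shows "\<exists>X Q J. topological_model E X Q J (2 ^ i * (L + 1) - 1) \<and> X \<noteq> {} \<and>
    card X * d ^ i \<le> card W * (32 * real t) ^ (i * i) \<and>
    (\<forall>v\<in>X. d / (32 * real t) ^ i \<le> card {w. {v, w} \<in> Q})"
  using assms(4,6)
proof (induction i)
  case 0
  then show ?case using assms by (intro exI[of _ W] exI[of _ R] exI[of _ I]) auto
next
  case (Suc i)
  define c where "c = 32 * real t"
  define M where "M = 2 ^ i * (L + 1) - 1"
  have M: "2 ^ Suc i * (L + 1) - 1 = 2 * M + 1"
  proof -
    have "2 ^ i * (L + 1) = Suc M" unfolding M_def by simp
    then show ?thesis by simp
  qed
  have c: "c \<ge> 1" using assms(3) by (simp add: c_def)
  then have "c ^ i \<le> c ^ Suc i" by (simp add: mult_le_cancel_right1)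
  then have "c ^ i \<le> d" using Suc.prems(1) unfolding c_def by linarith
  then have d: "d > 0" using c by (meson less_le_trans one_le_power zero_less_one)
  have none: "\<not> topological_model E T (nsets T 2) J (2 * M + 1)" if "card T = t" for T J
    using Suc.prems(2)[OF that] unfolding M .
  \<comment> \<open>Only the final length is excluded by hypothesis; a clique model with shorter
    paths is also one with that length bound.\<close>
  have "\<not> topological_model E T (nsets T 2) J (2 ^ i * (L + 1) - 1)" if "card T = t" for T J
    using none[OF that, of J] topological_model_mono[of E T _ J M T _ "2 * M + 1"]
    unfolding M_def[symmetric] by auto
  then obtain X Q J where X: "topological_model E X Q J M" "X \<noteq> {}"
    "card X * d ^ i \<le> card W * c ^ (i * i)" "\<And>v. v \<in> X \<Longrightarrow> d / c ^ i \<le> card {w. {v, w} \<in> Q}"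
    using Suc.IH[OF \<open>c ^ i \<le> d\<close>[unfolded c_def]] unfolding c_def M_def by blast
  have "32 * real t \<le> d / c ^ i"
    using Suc.prems(1) c unfolding c_def[symmetric] by (simp add: field_simps)
  from densify[OF X(1,2) assms(3) this X(4)] none
  obtain X' Q' J' where X': "topological_model E X' Q' J' (2 * M + 1)" "X' \<noteq> {}"
    "card X' * (d / c ^ i) \<le> 4 * t * card X"
    "\<And>v. v \<in> X' \<Longrightarrow> d / c ^ i / c \<le> card {w. {v, w} \<in> Q'}"
    unfolding c_def by blast
  have "card X' * d ^ Suc i = (card X' * (d / c ^ i)) * (c ^ i * d ^ i)"
    using c by simp
  also have "\<dots> \<le> (4 * t * card X) * (c ^ i * d ^ i)"
    using X'(3) c d by (intro mult_right_mono) auto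
  also have "\<dots> \<le> (c * card X) * (c ^ i * d ^ i)"
    using c d unfolding c_def by (intro mult_right_mono) auto
  also have "\<dots> = c ^ Suc i * (card X * d ^ i)" by (simp add: ac_simps)
  also have "\<dots> \<le> c ^ Suc i * (card W * c ^ (i * i))"
    using X(3) c by (intro mult_left_mono) auto
  also have "\<dots> = card W * c ^ (Suc i + i * i)" by (simp add: power_add ac_simps)
  also have "\<dots> \<le> card W * c ^ (Suc i * Suc i)"
    using c by (intro mult_left_mono power_increasing) auto
  finally have "card X' * d ^ Suc i \<le> card W * c ^ (Suc i * Suc i)" .
  moreover have "d / c ^ Suc i \<le> card {w. {v, w} \<in> Q'}" if "v \<in> X'" for v
    using X'(4)[OF that] by (simp add: mult.commute)
  ultimately show ?case
    using X'(1,2) unfolding M c_def by blast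
qed

text \<open>The number \<open>i\<close> precedes \<open>t\<close> in the quantifiers because it
  determines the path length, from which the application computes \<open>t\<close>. The choice
  \<open>2 \<le> \<epsilon> * i\<close> makes \<open>(n powr \<epsilon>) ^ i\<close> at least the
  square of \<open>n\<close>, while only one factor \<open>n\<close> is available for the
  vertices.\<close>

lemma dense_imp_clique_model:
  fixes \<epsilon> :: real
  assumes "0 < \<epsilon>"
  shows "\<exists>i. \<forall>t\<ge>1. \<exists>n0. \<forall>n\<ge>n0. \<forall>(E :: 'b rel) W R I L.
    topological_model E W R I L \<and> W \<noteq> {} \<and> card W \<le> n \<and> n powr \<epsilon> * card W \<le> 2 * card R \<longrightarrow>
    (\<exists>T J. card T = t \<and> topological_model E T (nsets T 2) J (2 ^ i * (L + 1) - 1))"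
proof -
  define i where "i = nat \<lceil>2 / \<epsilon>\<rceil>"
  have i: "2 \<le> \<epsilon> * i"
  proof -
    have "2 / \<epsilon> \<le> i" unfolding i_def by linarith
    then show ?thesis using assms by (simp add: field_simps)
  qed
  show ?thesis
  proof (rule exI[of _ i], intro allI impI)
    fix t :: nat assume t: "1 \<le> t"
    define c where "c = 32 * real t"
    have c: "c \<ge> 1" using t by (simp add: c_def)
    \<comment> \<open>Without a clique, some vertex of the last graph has at least
      \<open>d / c ^ i\<close> neighbours in it, so
      \<open>d * d ^ i \<le> n * c ^ (i * i + i)\<close>. Together with \<open>d \<ge> 1\<close> and
      \<open>n ^ 2 \<le> 4 ^ i * d ^ i\<close> this gives \<open>n \<le> K\<close>. The threshold
      \<open>n0\<close> prevents that and also ensures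
      \<open>c ^ i \<le> n powr \<epsilon> / 4\<close>, the degree needed for all rounds.\<close>
    define K where "K = 4 ^ i * c ^ (i * i + i)"
    define n0 where "n0 = nat \<lceil>max ((4 * c ^ i) powr (1 / \<epsilon>)) (K + 1)\<rceil>"
    show "\<exists>n0. \<forall>n\<ge>n0. \<forall>(E :: 'b rel) W R I L.
      topological_model E W R I L \<and> W \<noteq> {} \<and> card W \<le> n \<and> n powr \<epsilon> * card W \<le> 2 * card R \<longrightarrow>
      (\<exists>T J. card T = t \<and> topological_model E T (nsets T 2) J (2 ^ i * (L + 1) - 1))"
    proof (rule exI[of _ n0], intro allI impI)
      fix n and E :: "'b rel" and W R I L
      assume n: "n0 \<le> n" and "topological_model E W R I L \<and> W \<noteq> {} \<and> card W \<le> n \<and>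
        n powr \<epsilon> * card W \<le> 2 * card R"
      then have m: "topological_model E W R I L" and W: "W \<noteq> {}" "card W \<le> n"
        and R: "n powr \<epsilon> * card W \<le> 2 * card R" by auto
      have n1: "(4 * c ^ i) powr (1 / \<epsilon>) \<le> n" and n2: "K + 1 \<le> n"
        using n unfolding n0_def by linarith+
      have "K > 0" using c by (simp add: K_def)
      then have npos: "real n > 0" using n2 by linarith
      define d where "d = n powr \<epsilon> / 4"
      have "4 * c ^ i = ((4 * c ^ i) powr (1 / \<epsilon>)) powr \<epsilon>"
        using assms c by (simp add: powr_powr)
      also have "\<dots> \<le> n powr \<epsilon>" using n1 assms by (intro powr_mono2) auto
      finally have cd: "c ^ i \<le> d" by (simp add: d_def)
      then have d1: "d \<ge> 1" using c by (meson le_trans one_le_power order_trans)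
      note mD = topological_modelD[OF m]
      obtain X where X: "X \<subseteq> W" "X \<noteq> {}"
        "\<And>v. v \<in> X \<Longrightarrow> d \<le> card {w. {v, w} \<in> R \<inter> nsets X 2}"
        using min_degree_subgraph[of W R "n powr \<epsilon>"] mD(1,2) W R npos unfolding d_def by auto
      have mX: "topological_model E X (R \<inter> nsets X 2) I L"
        by (rule topological_model_mono[OF m X(1)]) auto
      show "\<exists>T J. card T = t \<and> topological_model E T (nsets T 2) J (2 ^ i * (L + 1) - 1)"
      proof (rule ccontr)
        assume "\<not> ?thesis"
        then obtain X' Q J where X': "topological_model E X' Q J (2 ^ i * (L + 1) - 1)" "X' \<noteq> {}"
          "card X' * d ^ i \<le> card X * c ^ (i * i)" "\<And>v. v \<in> X' \<Longrightarrow> d / c ^ i \<le> card {w. {v, w} \<in> Q}"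
          using densify_iterate[OF mX X(2) t cd[unfolded c_def] X(3)] unfolding c_def by blast
        note m'D = topological_modelD[OF X'(1)]
        obtain v where v: "v \<in> X'" using X'(2) by blast
        have "card {w. {v, w} \<in> Q} \<le> card X'"
          using m'D(1,5) by (intro card_mono) auto
        then have "d / c ^ i \<le> card X'" using X'(4)[OF v] by linarith
        then have "d / c ^ i * d ^ i \<le> card X' * d ^ i" using d1 by (intro mult_right_mono) auto
        also have "\<dots> \<le> card X * c ^ (i * i)" by (rule X'(3))
        also have "\<dots> \<le> n * c ^ (i * i)"
          using card_mono[OF mD(1) X(1)] W(2) c by (intro mult_right_mono) auto
        finally have "d * d ^ i \<le> n * c ^ (i * i + i)"
          using c by (simp add: field_simps power_add)
        moreover have "d ^ i \<le> d * d ^ i" using d1 by (simp add: mult_le_cancel_right1)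
        moreover have "4 ^ i * d ^ i = n powr (\<epsilon> * i)"
          unfolding d_def using npos by (simp add: power_divide powr_powr flip: powr_realpow)
        moreover have "n powr 2 \<le> n powr (\<epsilon> * i)"
          using n2 \<open>K > 0\<close> i by (intro powr_mono) auto
        moreover have "n powr 2 = n * real n" using npos by (simp add: power2_eq_square)
        ultimately have "n * real n \<le> 4 ^ i * (n * c ^ (i * i + i))"
          by (smt (verit) mult_left_mono zero_le_power)
        then have "real n \<le> K" using npos unfolding K_def by (simp add: ac_simps)
        then show False using n2 by simp
      qed
    qed
  qed
qed

section \<open>Models and subdivisions\<close>

lemma contains_subgraphI:
  assumes "pair_wf_digraph G" "pair_wf_digraph H" "inj_on g (pverts H)" "g ` pverts H \<subseteq> pverts G"
    "\<And>x y. (x, y) \<in> parcs H \<Longrightarrow> (g x, g y) \<in> parcs G"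
  shows "contains_subgraph G H"
    and "(\<And>x y. x \<in> pverts H \<Longrightarrow> y \<in> pverts H \<Longrightarrow> (g x, g y) \<in> parcs G \<Longrightarrow> (x, y) \<in> parcs H) \<Longrightarrow>
      contains_induced_subgraph G H"
proof -
  interpret G: pair_wf_digraph G by fact
  interpret H: pair_wf_digraph H by fact
  define K where "K = \<lparr>pverts = g ` pverts H, parcs = map_prod g g ` parcs H\<rparr>"
  define f where
    "f = \<lparr>iso_verts = g, iso_arcs = map_prod g g, iso_head = snd, iso_tail = fst\<rparr>"
  have "pair_wf_digraph K"
    by unfold_locales (auto simp: K_def dest: H.in_arcsD1 H.in_arcsD2)
  then interpret K: pair_wf_digraph K .
  have sub: "subgraph (with_proj K) (with_proj G)"
    using assms(4,5) G.wf_digraph K.wf_digraph by (auto simp: subgraph_def compatible_def K_def)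
  have inj: "inj_on (map_prod g g) (parcs H)"
  proof (rule inj_onI)
    fix e f assume ef: "e \<in> parcs H" "f \<in> parcs H" "map_prod g g e = map_prod g g f"
    then have "g (fst e) = g (fst f)" "g (snd e) = g (snd f)" by (auto simp: map_prod_def split_beta)
    then have "fst e = fst f" "snd e = snd f"
      using ef(1,2) assms(3) H.arc_fst_in_verts H.arc_snd_in_verts by (auto dest: inj_onD)
    then show "e = f" by (rule prod_eqI)
  qed
  have "pre_digraph.digraph_isomorphism (with_proj H) f"
    using H.wf_digraph assms(3) inj by (auto simp: pre_digraph.digraph_isomorphism_def f_def)
  moreover have "with_proj K = app_iso f (with_proj H)"
    by (simp add: app_iso_def f_def K_def with_proj_def)
  ultimately have iso: "digraph_iso (with_proj H) (with_proj K)"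
    unfolding digraph_iso_def by blast
  show "contains_subgraph G H" using sub iso unfolding contains_subgraph_def by blast
  assume refl: "\<And>x y. x \<in> pverts H \<Longrightarrow> y \<in> pverts H \<Longrightarrow> (g x, g y) \<in> parcs G \<Longrightarrow> (x, y) \<in> parcs H"
  have "parcs K = {e \<in> parcs G. fst e \<in> pverts K \<and> snd e \<in> pverts K}"
  proof (intro equalityI subsetI)
    fix e assume "e \<in> {e \<in> parcs G. fst e \<in> pverts K \<and> snd e \<in> pverts K}"
    then obtain x y where "x \<in> pverts H" "y \<in> pverts H" "e = (g x, g y)" "e \<in> parcs G"
      by (cases e) (auto simp: K_def)
    then show "e \<in> parcs K" using refl by (force simp: K_def)
  next
    fix e assume "e \<in> parcs K"
    then show "e \<in> {e \<in> parcs G. fst e \<in> pverts K \<and> snd e \<in> pverts K}"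
      using K.arc_fst_in_verts K.arc_snd_in_verts sub by (auto simp: subgraph_def)
  qed
  then show "contains_induced_subgraph G H"
    using sub iso unfolding contains_induced_subgraph_def induced_subgraph_def by auto
qed

lemma contains_subgraphE:
  assumes "contains_subgraph G H"
  obtains g where "inj_on g (pverts H)" "g ` pverts H \<subseteq> pverts G"
    "\<And>x y. (x, y) \<in> parcs H \<Longrightarrow> (g x, g y) \<in> parcs G"
proof -
  from assms obtain K f where K: "subgraph (with_proj K) (with_proj G)"
    and f: "pre_digraph.digraph_isomorphism (with_proj H) f" "with_proj K = app_iso f (with_proj H)"
    unfolding contains_subgraph_def digraph_iso_def by blast
  have eqs: "iso_verts f ` pverts H = pverts K" "iso_arcs f ` parcs H = parcs K"
      "iso_head f = snd" "iso_tail f = fst"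
    using f(2) by (auto simp: with_proj_def app_iso_def)
  have inj: "inj_on (iso_verts f) (pverts H)"
    using f(1) by (simp add: pre_digraph.digraph_isomorphism_def)
  have arc: "(iso_verts f x, iso_verts f y) \<in> parcs G" if xy: "(x, y) \<in> parcs H" for x y
  proof -
    have "iso_verts f x = fst (iso_arcs f (x, y))" "iso_verts f y = snd (iso_arcs f (x, y))"
      using f(1) xy eqs(3,4) by (auto simp: pre_digraph.digraph_isomorphism_def)
    moreover have "iso_arcs f (x, y) \<in> parcs K" using xy eqs(2) by blast
    moreover have "parcs K \<subseteq> parcs G" using K by (simp add: subgraph_def)
    ultimately show ?thesis by auto
  qed
  have "pverts K \<subseteq> pverts G" using K by (simp add: subgraph_def)
  then show ?thesis using that[OF inj _ arc] eqs(1) by simp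
qed

text \<open>The map from arcs to unordered pairs is exactly two-to-one: symmetry supplies both
  orientations, the absence of loops keeps them distinct, and injectivity of \<open>\<sigma>\<close>
  admits no others.\<close>

lemma card_sym_arcs:
  assumes "finite A" "sym A" "inj_on \<sigma> V" "A \<subseteq> V \<times> V" "\<And>a. (a, a) \<notin> A"
  shows "card A = 2 * card ((\<lambda>(a, b). {\<sigma> a, \<sigma> b}) ` A)"
proof -
  let ?f = "\<lambda>(a, b). {\<sigma> a, \<sigma> b}"
  have "card {x \<in> A. ?f x = r} = 2" if r: "r \<in> ?f ` A" for r
  proof -
    obtain a b where ab: "(a, b) \<in> A" "r = {\<sigma> a, \<sigma> b}" using r by auto
    have V: "a \<in> V" "b \<in> V" "a \<noteq> b" using ab(1) assms(4,5) by auto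
    have "x = (a, b) \<or> x = (b, a)" if "x \<in> A" "?f x = r" for x
      using that V assms(3,4) ab(2) by (cases x) (auto simp: doubleton_eq_iff dest: inj_onD)
    moreover have "(b, a) \<in> A" using ab(1) assms(2) by (auto dest: symD)
    ultimately have "{x \<in> A. ?f x = r} = {(a, b), (b, a)}" using ab by auto
    then show ?thesis using V(3) by auto
  qed
  then have "(\<Sum>r\<in>?f ` A. card {x \<in> A. ?f x = r}) = (\<Sum>r\<in>?f ` A. 2)"
    by (intro sum.cong refl)
  moreover have "card A = (\<Sum>r\<in>?f ` A. card {x \<in> A. ?f x = r})"
    using sum.image_gen[OF assms(1), of "\<lambda>_. 1::nat" ?f] by simp
  ultimately show ?thesis by simp
qed

text \<open>The inner vertices of an induced path through \<open>S\<close> already link its ends, so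
  minimality makes them all of \<open>S\<close>. This turns the size of \<open>S\<close> into the
  exact number of subdividing vertices.\<close>

lemma minimal_linked_path:
  assumes "linked E S u v" "u \<noteq> v" "v \<notin> S" "\<And>T. T \<subset> S \<Longrightarrow> \<not> linked E T u v"
  shows "\<exists>p. p 0 = u \<and> p (Suc (card S)) = v \<and> inj_on p {..Suc (card S)} \<and> p ` {1..card S} = S \<and>
    (\<forall>i\<le>card S. (p i, p (Suc i)) \<in> E) \<and>
    (\<forall>i j. i < j \<longrightarrow> j \<le> Suc (card S) \<longrightarrow> (p i, p j) \<in> E \<longrightarrow> j = Suc i)"
proof -
  obtain p l where p: "walk_via E S p l" "p 0 = u" "p l = v" "inj_on p {..l}"
    "\<And>i j. i < j \<Longrightarrow> j \<le> l \<Longrightarrow> (p i, p j) \<in> E \<Longrightarrow> j = Suc i"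
    using linked_imp_induced_path[OF assms(1-3)] by metis
  define T where "T = p ` {1..l - 1}"
  have l: "l \<noteq> 0" using p(2,3) assms(2) by metis
  have "T \<subseteq> S" using p(1) by (auto simp: T_def walk_via_def)
  moreover have "walk_via E T p l" using p(1) by (auto simp: T_def walk_via_def)
  then have "linked E T u v" using p(2,3) unfolding linked_def by blast
  ultimately have T: "T = S" using assms(4) by blast
  have "inj_on p {1..l - 1}" using p(4) by (rule inj_on_subset) auto
  then have "card S = l - 1" unfolding T[symmetric] T_def by (simp add: card_image)
  then have "Suc (card S) = l" using l by simp
  moreover have "p ` {1..card S} = S" using T \<open>card S = l - 1\<close> by (simp add: T_def)
  moreover have "\<forall>i\<le>card S. (p i, p (Suc i)) \<in> E"
    using p(1) \<open>Suc (card S) = l\<close> by (auto simp: walk_via_def)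
  ultimately show ?thesis using p by (intro exI[of _ p]) auto
qed

lemma subdivided_cong:
  assumes "\<And>e. e \<in> edge_reps F \<Longrightarrow> s e = s' e"
  shows "subdivided F s = subdivided F s'"
proof -
  have "sd_vertex s e i = sd_vertex s' e i" if "e \<in> edge_reps F" for e i
    using assms[OF that] by (simp add: sd_vertex_def)
  then have "sd_arcs F s = sd_arcs F s'"
    unfolding sd_arcs_def using assms by (metis (no_types, lifting))
  then show ?thesis unfolding subdivided_def using assms by (auto 0 3)
qed

lemma edge_reps_cases:
  fixes F :: "'a::linorder pair_pre_digraph"
  assumes "pair_graph F" "(a, b) \<in> parcs F"
  obtains "(a, b) \<in> edge_reps F" | "(b, a) \<in> edge_reps F"
proof -
  interpret pair_graph F by fact
  have "a \<noteq> b" "(b, a) \<in> parcs F" using assms(2) no_loops' arcs_symmetric by auto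
  then show ?thesis using assms(2) that by (cases "a < b") (auto simp: edge_reps_def)
qed

lemma sd_arcs_subdivided:
  assumes "e \<in> edge_reps F" "i \<le> s e"
  shows "(sd_vertex s e i, sd_vertex s e (Suc i)) \<in> parcs (subdivided F s) \<and>
    (sd_vertex s e (Suc i), sd_vertex s e i) \<in> parcs (subdivided F s)"
proof -
  have "(sd_vertex s e i, sd_vertex s e (i + 1)) \<in> sd_arcs F s"
    unfolding sd_arcs_def using assms by blast
  then show ?thesis by (simp add: subdivided_def)
qed

text \<open>
  An inclusion-minimal linking set is exactly the set of inner vertices of an induced path.
\<close>

definition minimal_model ::
  "'b rel \<Rightarrow> 'b set \<Rightarrow> 'b set set \<Rightarrow> ('b set \<Rightarrow> 'b set) \<Rightarrow> nat \<Rightarrow> bool" where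
  "minimal_model E W R I L \<longleftrightarrow> topological_model E W R I L \<and>
     (\<forall>u v T. {u, v} \<in> R \<longrightarrow> T \<subset> I {u, v} \<longrightarrow> \<not> linked E T u v)"

text \<open>These are the arcs that could spoil an induced copy: between branch vertices, from an
  inner vertex to a branch vertex that is not an end of its path, and between different paths.
  Chords of a single path, ends included, are excluded by minimality.\<close>

definition induced_model ::
  "'b rel \<Rightarrow> 'b set \<Rightarrow> 'b set set \<Rightarrow> ('b set \<Rightarrow> 'b set) \<Rightarrow> nat \<Rightarrow> bool" where
  "induced_model E W R I L \<longleftrightarrow> minimal_model E W R I L \<and>
     (\<forall>u v. u \<in> W \<longrightarrow> v \<in> W \<longrightarrow> (u, v) \<in> E \<longrightarrow> {u, v} \<in> R) \<and>
     (\<forall>e x w. e \<in> R \<longrightarrow> x \<in> I e \<longrightarrow> w \<in> W \<longrightarrow> (x, w) \<in> E \<longrightarrow> w \<in> e) \<and>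
     (\<forall>e f x y. e \<in> R \<longrightarrow> f \<in> R \<longrightarrow> x \<in> I e \<longrightarrow> y \<in> I f \<longrightarrow> (x, y) \<in> E \<longrightarrow> e = f)"

section \<open>From models to subdivisions\<close>

text \<open>Numbering \<open>W\<close> gives \<open>F\<close>, and \<open>g\<close> lays the new
  vertices of each edge along its induced path, oriented by the increasing arc. The last conclusion
  is conditional so that one construction serves both cliques, where arcs only have to be preserved,
  and induced copies, where they have to be reflected as well.\<close>

lemma minimal_model_embedding:
  assumes E: "sym E" "\<And>x. (x, x) \<notin> E" and min: "minimal_model E W R I L"
  obtains F :: "nat pair_pre_digraph" and \<sigma> s g where
    "pair_graph F" "bij_betw \<sigma> (pverts F) W"
    "parcs F = {(a, b). a \<in> pverts F \<and> b \<in> pverts F \<and> {\<sigma> a, \<sigma> b} \<in> R}"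
    "card (parcs F) = 2 * card R"
    "\<And>e. e \<in> edge_reps F \<Longrightarrow> {\<sigma> (fst e), \<sigma> (snd e)} \<in> R \<and> s e = card (I {\<sigma> (fst e), \<sigma> (snd e)})"
    "inj_on g (pverts (subdivided F s))" "g ` pverts (subdivided F s) \<subseteq> W \<union> \<Union> (I ` R)"
    "\<And>x y. (x, y) \<in> parcs (subdivided F s) \<Longrightarrow> (g x, g y) \<in> E"
    "\<And>x y. induced_model E W R I L \<Longrightarrow> x \<in> pverts (subdivided F s) \<Longrightarrow> y \<in> pverts (subdivided F s) \<Longrightarrow>
       (g x, g y) \<in> E \<Longrightarrow> (x, y) \<in> parcs (subdivided F s)"
proof -
  have m: "topological_model E W R I L"
    and mm: "\<And>u v T. {u, v} \<in> R \<Longrightarrow> T \<subset> I {u, v} \<Longrightarrow> \<not> linked E T u v"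
    using min unfolding minimal_model_def by blast+
  note mD = topological_modelD[OF m]
  obtain \<sigma> where \<sigma>: "bij_betw \<sigma> {0..<card W} W" using ex_bij_betw_nat_finite[OF mD(1)] by blast
  have \<sigma>i: "\<sigma> a = \<sigma> b \<longleftrightarrow> a = b" if "a < card W" "b < card W" for a b
    using \<sigma> that by (auto simp: bij_betw_def inj_on_def)
  have \<sigma>W: "\<sigma> a \<in> W" if "a < card W" for a using \<sigma> that by (auto simp: bij_betw_def)
  define F :: "nat pair_pre_digraph" where
    "F = \<lparr>pverts = {0..<card W}, parcs = {(a, b). a < card W \<and> b < card W \<and> {\<sigma> a, \<sigma> b} \<in> R}\<rparr>"
  have finF: "finite (parcs F)"
    by (rule finite_subset[of _ "{0..<card W} \<times> {0..<card W}"]) (auto simp: F_def)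
  have loop: "(a, a) \<notin> parcs F" for a using mD(5)[of "\<sigma> a" "\<sigma> a"] by (auto simp: F_def)
  have symF: "sym (parcs F)" by (auto simp: F_def sym_def insert_commute)
  have pvF: "pverts F = {0..<card W}" by (simp add: F_def)
  have arcF: "fst e \<in> pverts F" "snd e \<in> pverts F" "fst e \<noteq> snd e" if "e \<in> parcs F" for e
    using that loop[of "fst e"] by (cases e, auto simp: F_def)+
  have "symmetric (with_proj F)" using symF by (simp add: symmetric_def)
  then have F: "pair_graph F"
    by unfold_locales (use finF arcF pvF in simp_all)
  define r where "r = (\<lambda>e :: nat \<times> nat. {\<sigma> (fst e), \<sigma> (snd e)})"
  have rR: "r e \<in> R" "fst e < card W" "snd e < card W" "fst e < snd e" if "e \<in> edge_reps F" for e
    using that by (auto simp: edge_reps_def F_def r_def)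
  have rinj: "e = f" if "e \<in> edge_reps F" "f \<in> edge_reps F" "r e = r f" for e f
    using rR(2-4)[OF that(1)] rR(2-4)[OF that(2)] that(3)
    by (auto simp: r_def doubleton_eq_iff \<sigma>i intro: prod_eqI)
  have imR: "(\<lambda>(a, b). {\<sigma> a, \<sigma> b}) ` parcs F = R"
  proof (intro equalityI subsetI)
    fix e assume e: "e \<in> R"
    then obtain u v where uv: "e = {u, v}" "u \<in> W" "v \<in> W"
      using mD(2) unfolding nsets_2_eq by blast
    have "\<sigma> ` {0..<card W} = W" using \<sigma> by (simp add: bij_betw_def)
    then obtain a b where "u = \<sigma> a" "v = \<sigma> b" "a < card W" "b < card W"
      using uv(2,3) by (metis (no_types, lifting) atLeastLessThan_iff imageE)
    then have "(a, b) \<in> parcs F" "e = {\<sigma> a, \<sigma> b}" using e uv by (auto simp: F_def)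
    then show "e \<in> (\<lambda>(a, b). {\<sigma> a, \<sigma> b}) ` parcs F" by blast
  qed (auto simp: F_def)
  have card_arcs: "card (parcs F) = 2 * card R"
  proof -
    have "inj_on \<sigma> {0..<card W}" using \<sigma> by (simp add: bij_betw_def)
    moreover have "parcs F \<subseteq> {0..<card W} \<times> {0..<card W}" by (auto simp: F_def)
    ultimately have "card (parcs F) = 2 * card ((\<lambda>(a, b). {\<sigma> a, \<sigma> b}) ` parcs F)"
      using loop by (rule card_sym_arcs[OF finF symF])
    then show ?thesis unfolding imR .
  qed
  define s where "s = (\<lambda>e. card (I (r e)))"
  define P where "P = (\<lambda>e p. p 0 = \<sigma> (fst e) \<and> p (Suc (s e)) = \<sigma> (snd e) \<and>
    inj_on p {..Suc (s e)} \<and> p ` {1..s e} = I (r e) \<and> (\<forall>i\<le>s e. (p i, p (Suc i)) \<in> E) \<and>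
    (\<forall>i j. i < j \<longrightarrow> j \<le> Suc (s e) \<longrightarrow> (p i, p j) \<in> E \<longrightarrow> j = Suc i))"
  have "\<exists>p. P e p" if e: "e \<in> edge_reps F" for e
    using minimal_linked_path[of E "I (r e)" "\<sigma> (fst e)" "\<sigma> (snd e)"] rR[OF e] mD(4,5,8) mm
    unfolding P_def s_def r_def by metis
  then obtain p where p: "\<And>e. e \<in> edge_reps F \<Longrightarrow> P e (p e)" by metis
  have pD: "p e 0 = \<sigma> (fst e)" "p e (Suc (s e)) = \<sigma> (snd e)"
    "\<And>i j. i \<le> Suc (s e) \<Longrightarrow> j \<le> Suc (s e) \<Longrightarrow> p e i = p e j \<Longrightarrow> i = j"
    "\<And>i. 1 \<le> i \<Longrightarrow> i \<le> s e \<Longrightarrow> p e i \<in> I (r e)" "\<And>i. i \<le> s e \<Longrightarrow> (p e i, p e (Suc i)) \<in> E"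
    "\<And>i j. i < j \<Longrightarrow> j \<le> Suc (s e) \<Longrightarrow> (p e i, p e j) \<in> E \<Longrightarrow> j = Suc i" if "e \<in> edge_reps F" for e
    using p[OF that] unfolding P_def inj_on_def by auto
  define g where "g = (\<lambda>x. case x of Inl a \<Rightarrow> \<sigma> a | Inr (e, i) \<Rightarrow> p e i)"
  have gsd: "g (sd_vertex s e i) = p e i" if "e \<in> edge_reps F" "i \<le> Suc (s e)" for e i
    using pD(1,2)[OF that(1)] that(2) by (auto simp: g_def sd_vertex_def le_Suc_eq)
  have vcases: "(\<exists>a. x = Inl a \<and> a < card W) \<or>
      (\<exists>e i. x = Inr (e, i) \<and> e \<in> edge_reps F \<and> 1 \<le> i \<and> i \<le> s e)"
    if "x \<in> pverts (subdivided F s)" for x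
    using that pvF by (auto simp: subdivided_def)
  have injg: "inj_on g (pverts (subdivided F s))"
  proof (rule inj_onI)
    have mixed: "\<sigma> a \<noteq> p e i" if "a < card W" "e \<in> edge_reps F" "1 \<le> i" "i \<le> s e" for a e i
      using pD(4)[OF that(2-4)] mD(8)[OF rR(1)[OF that(2)]] \<sigma>W[OF that(1)] by metis
    fix x y assume "x \<in> pverts (subdivided F s)" "y \<in> pverts (subdivided F s)" and eq: "g x = g y"
    from this(1,2)[THEN vcases] show "x = y"
    proof (elim disjE exE conjE)
      fix e i f j
      assume x: "x = Inr (e, i)" "e \<in> edge_reps F" "1 \<le> i" "i \<le> s e"
        and y: "y = Inr (f, j)" "f \<in> edge_reps F" "1 \<le> j" "j \<le> s f"
      have "p e i = p f j" using eq x y by (simp add: g_def)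
      then have "e = f"
        using pD(4)[OF x(2-4)] pD(4)[OF y(2-4)] mD(10) rR(1) rinj x(2) y(2) by metis
      then show "x = y" using pD(3)[OF x(2), of i j] \<open>p e i = p f j\<close> x y by simp
    qed (use eq mixed \<sigma>i in \<open>auto simp: g_def dest: sym\<close>)
  qed
  have gsub: "g ` pverts (subdivided F s) \<subseteq> W \<union> \<Union> (I ` R)"
    using vcases \<sigma>W pD(4) rR(1) by (fastforce simp: g_def)
  have garc: "(g x, g y) \<in> E" if "(x, y) \<in> parcs (subdivided F s)" for x y
  proof -
    from that obtain e i where e: "e \<in> edge_reps F" "i \<le> s e" and
      "(x, y) = (sd_vertex s e i, sd_vertex s e (i + 1)) \<or>
       (x, y) = (sd_vertex s e (i + 1), sd_vertex s e i)"
      by (auto simp: subdivided_def sd_arcs_def)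
    then show ?thesis using pD(5)[OF e] gsd[OF e(1)] e(2) E(1) by (auto dest: symD)
  qed
  have arcI: "(sd_vertex s e i, sd_vertex s e (Suc i)) \<in> parcs (subdivided F s)"
    "(sd_vertex s e (Suc i), sd_vertex s e i) \<in> parcs (subdivided F s)"
    if "e \<in> edge_reps F" "i \<le> s e" for e i
    using sd_arcs_subdivided[where s = s, OF that] by blast+
  have refl: "(x, y) \<in> parcs (subdivided F s)"
    if ind: "induced_model E W R I L" and xy: "x \<in> pverts (subdivided F s)"
      "y \<in> pverts (subdivided F s)" and arc: "(g x, g y) \<in> E" for x y
  proof -
    have ind': "\<And>u v. u \<in> W \<Longrightarrow> v \<in> W \<Longrightarrow> (u, v) \<in> E \<Longrightarrow> {u, v} \<in> R"
      "\<And>e x w. e \<in> R \<Longrightarrow> x \<in> I e \<Longrightarrow> w \<in> W \<Longrightarrow> (x, w) \<in> E \<Longrightarrow> w \<in> e"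
      "\<And>e f x y. e \<in> R \<Longrightarrow> f \<in> R \<Longrightarrow> x \<in> I e \<Longrightarrow> y \<in> I f \<Longrightarrow> (x, y) \<in> E \<Longrightarrow> e = f"
      using ind unfolding induced_model_def by blast+
    \<comment> \<open>Such a branch vertex must be an end of the path of \<open>e\<close>; having no
      chord, the path meets its ends only through its first and last inner vertices.\<close>
    have mixed: "(Inl a, Inr (e, i)) \<in> parcs (subdivided F s) \<and> (Inr (e, i), Inl a) \<in> parcs (subdivided F s)"
      if a: "a < card W" and e: "e \<in> edge_reps F" and i: "1 \<le> i" "i \<le> s e" and "(p e i, \<sigma> a) \<in> E"
      for a e i
    proof -
      have "\<sigma> a \<in> r e" using ind'(2) rR(1)[OF e] pD(4)[OF e i] \<sigma>W[OF a] that(5) by blast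
      then consider "a = fst e" | "a = snd e" using a rR(2,3)[OF e] \<sigma>i by (auto simp: r_def)
      then show ?thesis
      proof cases
        case 1
        then have "(p e 0, p e i) \<in> E" using pD(1)[OF e] that(5) E(1) by (auto dest: symD)
        then have "i = 1" using pD(6)[OF e, of 0 i] i by auto
        then show ?thesis using arcI[OF e, of 0] i 1 by (auto simp: sd_vertex_def)
      next
        case 2
        then have "(p e i, p e (Suc (s e))) \<in> E" using pD(2)[OF e] that(5) by auto
        then have "i = s e" using pD(6)[OF e, of i "Suc (s e)"] i by auto
        then show ?thesis using arcI[OF e, of i] i 2 by (auto simp: sd_vertex_def)
      qed
    qed
    from xy[THEN vcases] show ?thesis
    proof (elim disjE exE conjE)
      fix a b assume x: "x = Inl a" "a < card W" and y: "y = Inl b" "b < card W"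
      have ab: "(\<sigma> a, \<sigma> b) \<in> E" using arc x y by (simp add: g_def)
      have "{\<sigma> a, \<sigma> b} \<in> R" using ab \<sigma>W x y ind'(1) by blast
      then have "(a, b) \<in> parcs F" using x y by (simp add: F_def)
      \<comment> \<open>Adjacent branch vertices are linked by the empty set, so minimality leaves
        this edge unsubdivided and the arc joins two old vertices directly.\<close>
      moreover have "I {\<sigma> a, \<sigma> b} = {}"
        using mm[OF \<open>{\<sigma> a, \<sigma> b} \<in> R\<close>, of "{}"] linked_arc[OF ab] by blast
      ultimately show ?thesis
        using arcI[of "(a, b)" 0] arcI[of "(b, a)" 0] F x y
        by (elim edge_reps_cases[OF F]) (auto simp: s_def r_def sd_vertex_def insert_commute)
    next
      fix a e i assume "x = Inl a" "a < card W" "y = Inr (e, i)" "e \<in> edge_reps F" "1 \<le> i" "i \<le> s e"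
      then show ?thesis using mixed[of a e i] arc E(1) by (auto simp: g_def dest: symD)
    next
      fix a e i assume "y = Inl a" "a < card W" "x = Inr (e, i)" "e \<in> edge_reps F" "1 \<le> i" "i \<le> s e"
      then show ?thesis using mixed[of a e i] arc by (auto simp: g_def)
    next
      fix e i f j
      assume x: "x = Inr (e, i)" "e \<in> edge_reps F" "1 \<le> i" "i \<le> s e"
        and y: "y = Inr (f, j)" "f \<in> edge_reps F" "1 \<le> j" "j \<le> s f"
      have a: "(p e i, p f j) \<in> E" using arc x y by (simp add: g_def)
      then have ef: "e = f"
        using ind'(3) rR(1) pD(4)[OF x(2-4)] pD(4)[OF y(2-4)] rinj x(2) y(2) by metis
      have "i \<noteq> j" using a ef E(2) by auto
      moreover have "j = Suc i" if "i < j" using pD(6)[OF x(2) that] a ef y by auto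
      moreover have "i = Suc j" if "j < i" using pD(6)[OF x(2) that] a ef x E(1) by (auto dest: symD)
      ultimately have "j = Suc i \<or> i = Suc j" by linarith
      then show ?thesis
        using arcI[OF x(2), of i] arcI[OF x(2), of j] x y ef by (auto simp: sd_vertex_def)
    qed
  qed
  show ?thesis
  proof (rule that[OF F _ _ card_arcs _ injg gsub garc refl])
    show "bij_betw \<sigma> (pverts F) W" using \<sigma> by (simp add: F_def)
    show "parcs F = {(a, b). a \<in> pverts F \<and> b \<in> pverts F \<and> {\<sigma> a, \<sigma> b} \<in> R}" by (simp add: F_def)
    show "{\<sigma> (fst e), \<sigma> (snd e)} \<in> R \<and> s e = card (I {\<sigma> (fst e), \<sigma> (snd e)})"
      if "e \<in> edge_reps F" for e
      using rR(1)[OF that] by (simp add: s_def r_def)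
  qed
qed

text \<open>Each inner vertex is the tail of an arc. A topological model does not place its inner
  sets inside the vertex set of the host graph; this does so for minimal ones.\<close>

lemma linked_Int_Field:
  assumes "linked E S u v"
  shows "linked E (S \<inter> Field E) u v"
proof -
  obtain p l where p: "walk_via E S p l" "p 0 = u" "p l = v"
    using assms unfolding linked_def by blast
  have "p i \<in> Field E" if "i < l" for i
    using p(1) that unfolding walk_via_def by (meson FieldI1)
  then have "walk_via E (S \<inter> Field E) p l" using p(1) by (auto simp: walk_via_def)
  then show ?thesis using p unfolding linked_def by blast
qed

lemma minimal_model_exists:
  assumes "sym E" and m: "topological_model E W R I L"
  obtains J where "minimal_model E W R J L" "\<And>e. e \<in> R \<Longrightarrow> J e \<subseteq> I e \<inter> Field E"
proof -
  note mD = topological_modelD[OF m]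
  \<comment> \<open>Both orientations of \<open>e\<close> are demanded, so that the chosen set
    depends on the unordered pair only; by symmetry either orientation implies the other, which
    makes the set minimal for each of them.\<close>
  define P where "P = (\<lambda>e T. \<forall>u v. e = {u, v} \<longrightarrow> linked E T u v)"
  have "\<exists>T. T \<subseteq> I e \<inter> Field E \<and> P e T \<and> (\<forall>T'. T' \<subset> T \<longrightarrow> \<not> P e T')" if e: "e \<in> R" for e
  proof -
    let ?\<T> = "{T. T \<subseteq> I e \<inter> Field E \<and> P e T}"
    have "finite ?\<T>"
      by (rule finite_subset[of _ "Pow (I e)"]) (use mD(6)[OF e] in auto)
    moreover have "linked E (I e \<inter> Field E) u v" if "e = {u, v}" for u v
      using linked_Int_Field[OF mD(4)[of u v]] e that by simp
    then have "I e \<inter> Field E \<in> ?\<T>" by (simp add: P_def)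
    ultimately obtain T where T: "T \<in> ?\<T>" "\<And>T'. T' \<in> ?\<T> \<Longrightarrow> T' \<subseteq> T \<Longrightarrow> T = T'"
      using finite_has_minimal[of ?\<T>] by (metis (no_types, lifting) empty_iff)
    have "\<not> P e T'" if "T' \<subset> T" for T' using T(1) T(2)[of T'] that by blast
    then show ?thesis using T(1) by blast
  qed
  then obtain J where J: "\<And>e. e \<in> R \<Longrightarrow> J e \<subseteq> I e \<inter> Field E" "\<And>e. e \<in> R \<Longrightarrow> P e (J e)"
    "\<And>e T. e \<in> R \<Longrightarrow> T \<subset> J e \<Longrightarrow> \<not> P e T" by metis
  have fin: "finite (J e) \<and> card (J e) \<le> L \<and> J e \<inter> W = {}" if "e \<in> R" for e
  proof -
    have sub: "J e \<subseteq> I e" using J(1)[OF that] by blast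
    then have "card (J e) \<le> card (I e)" using mD(6)[OF that] by (intro card_mono)
    moreover have "finite (J e)" using sub mD(6)[OF that] by (rule finite_subset)
    moreover have "J e \<inter> W = {}" using sub mD(8)[OF that] by blast
    ultimately show ?thesis using mD(7)[OF that] by linarith
  qed
  moreover have "disjoint_family_on J R"
    using mD(9) J(1) unfolding disjoint_family_on_def by blast
  moreover have "linked E (J {u, v}) u v" if "{u, v} \<in> R" for u v
    using J(2)[OF that] unfolding P_def by blast
  ultimately have "topological_model E W R J L"
    using mD(1,2) unfolding topological_model_def by blast
  moreover have "\<not> linked E T u v" if "{u, v} \<in> R" "T \<subset> J {u, v}" for u v T
  proof
    assume "linked E T u v"
    then have "P {u, v} T"
      using linked_sym[OF assms(1)] unfolding P_def by (auto simp: doubleton_eq_iff)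
    then show False using J(3) that by blast
  qed
  ultimately show ?thesis using that[of J] J(1) unfolding minimal_model_def by blast
qed

text \<open>Inner vertices belong to \<open>G\<close> because they lie on arcs. A lone branch vertex
  lies on none, so the branch set is assumed to be in \<open>G\<close>.\<close>

lemma clique_model_imp_contains_subgraph:
  fixes G :: "'a pair_pre_digraph"
  assumes G: "pair_graph G" and m: "topological_model (parcs G) W (nsets W 2) I L" and "W \<subseteq> pverts G"
  shows "\<exists>F :: nat pair_pre_digraph. complete_digraph (card W) (with_proj F) \<and>
    (\<exists>H \<in> le_subdivisions L F. contains_subgraph G H)"
proof -
  interpret G: pair_graph G by fact
  have E: "sym (parcs G)" "(x, x) \<notin> parcs G" for x
    using G.arcs_symmetric G.no_loops' by (auto intro: symI)
  have field: "Field (parcs G) \<subseteq> pverts G"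
    using G.in_arcsD1 G.in_arcsD2 by (auto simp: Field_def)
  obtain J where J: "minimal_model (parcs G) W (nsets W 2) J L"
    "\<And>e. e \<in> nsets W 2 \<Longrightarrow> J e \<subseteq> I e \<inter> Field (parcs G)"
    using minimal_model_exists[OF E(1) m] by blast
  then have Jm: "topological_model (parcs G) W (nsets W 2) J L" by (simp add: minimal_model_def)
  obtain F :: "nat pair_pre_digraph" and \<sigma> s g where
    F: "pair_graph F" "bij_betw \<sigma> (pverts F) W" and
    arcs: "parcs F = {(a, b). a \<in> pverts F \<and> b \<in> pverts F \<and> {\<sigma> a, \<sigma> b} \<in> nsets W 2}" and
    "card (parcs F) = 2 * card (nsets W 2)" and
    s: "\<And>e. e \<in> edge_reps F \<Longrightarrow>
      {\<sigma> (fst e), \<sigma> (snd e)} \<in> nsets W 2 \<and> s e = card (J {\<sigma> (fst e), \<sigma> (snd e)})" and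
    g: "inj_on g (pverts (subdivided F s))"
      "g ` pverts (subdivided F s) \<subseteq> W \<union> \<Union> (J ` nsets W 2)"
      "\<And>x y. (x, y) \<in> parcs (subdivided F s) \<Longrightarrow> (g x, g y) \<in> parcs G" and
    "\<And>x y. induced_model (parcs G) W (nsets W 2) J L \<Longrightarrow> x \<in> pverts (subdivided F s) \<Longrightarrow>
      y \<in> pverts (subdivided F s) \<Longrightarrow> (g x, g y) \<in> parcs G \<Longrightarrow> (x, y) \<in> parcs (subdivided F s)"
    by (rule minimal_model_embedding[OF E J(1)]) (rule that)
  interpret F: pair_graph F by fact
  have "card (pverts F) = card W" using F(2) by (rule bij_betw_same_card)
  moreover have "parcs F = {(a, b). (a, b) \<in> pverts F \<times> pverts F \<and> a \<noteq> b}"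
    using F(2) unfolding arcs bij_betw_def inj_on_def by auto
  ultimately have "complete_digraph (card W) (with_proj F)"
    unfolding complete_digraph_pair_def using F.pair_finite_verts by simp
  moreover have "s e \<le> L" if "e \<in> edge_reps F" for e
    using s[OF that] topological_modelD(7)[OF Jm] by simp
  then have "subdivided F s \<in> le_subdivisions L F"
    unfolding le_subdivisions_def by blast
  moreover have "contains_subgraph G (subdivided F s)"
  proof (rule contains_subgraphI(1)[OF _ _ g(1) _ g(3)])
    interpret S: pair_graph "subdivided F s" using F(1) by (rule pair_graph_subdivided)
    show "pair_wf_digraph (subdivided F s)" by (rule S.pair_wf_digraph)
    show "g ` pverts (subdivided F s) \<subseteq> pverts G"
      using g(2) assms(3) J(2) field by blast
  qed (rule G.pair_wf_digraph)
  ultimately show ?thesis by blast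
qed

lemma induced_model_imp_contains_induced_subgraph:
  fixes G :: "'a pair_pre_digraph"
  assumes G: "pair_graph G" and m: "induced_model (parcs G) W R I L" and j: "\<And>e. e \<in> R \<Longrightarrow> card (I e) = j"
    and "W \<subseteq> pverts G" "W \<noteq> {}"
  shows "\<exists>F :: nat pair_pre_digraph. simple_graph F \<and> avg_degree F = 2 * card R / card W \<and>
    contains_induced_subgraph G (k_subdivision j F)"
proof -
  interpret G: pair_graph G by fact
  have E: "sym (parcs G)" "(x, x) \<notin> parcs G" for x
    using G.arcs_symmetric G.no_loops' by (auto intro: symI)
  have field: "Field (parcs G) \<subseteq> pverts G"
    using G.in_arcsD1 G.in_arcsD2 by (auto simp: Field_def)
  have mm: "minimal_model (parcs G) W R I L" and tm: "topological_model (parcs G) W R I L"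
    using m by (simp_all add: induced_model_def minimal_model_def)
  note mD = topological_modelD[OF tm]
  \<comment> \<open>Intersecting with the field preserves linkage, so by minimality nothing can be
    lost.\<close>
  have "I e \<subseteq> Field (parcs G)" if e: "e \<in> R" for e
  proof -
    obtain u v where uv: "e = {u, v}" using e mD(2) unfolding nsets_2_eq by blast
    then have "linked (parcs G) (I e \<inter> Field (parcs G)) u v"
      using linked_Int_Field[OF mD(4)[of u v]] e by simp
    then have "\<not> I e \<inter> Field (parcs G) \<subset> I e" using mm uv e unfolding minimal_model_def by blast
    then show ?thesis by blast
  qed
  then have IG: "\<Union> (I ` R) \<subseteq> pverts G" using field by blast
  obtain F :: "nat pair_pre_digraph" and \<sigma> s g where
    F: "pair_graph F" "bij_betw \<sigma> (pverts F) W" and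
    "parcs F = {(a, b). a \<in> pverts F \<and> b \<in> pverts F \<and> {\<sigma> a, \<sigma> b} \<in> R}" and
    arcs: "card (parcs F) = 2 * card R" and
    s: "\<And>e. e \<in> edge_reps F \<Longrightarrow> {\<sigma> (fst e), \<sigma> (snd e)} \<in> R \<and> s e = card (I {\<sigma> (fst e), \<sigma> (snd e)})" and
    g: "inj_on g (pverts (subdivided F s))" "g ` pverts (subdivided F s) \<subseteq> W \<union> \<Union> (I ` R)"
      "\<And>x y. (x, y) \<in> parcs (subdivided F s) \<Longrightarrow> (g x, g y) \<in> parcs G"
      "\<And>x y. induced_model (parcs G) W R I L \<Longrightarrow> x \<in> pverts (subdivided F s) \<Longrightarrow>
        y \<in> pverts (subdivided F s) \<Longrightarrow> (g x, g y) \<in> parcs G \<Longrightarrow> (x, y) \<in> parcs (subdivided F s)"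
    by (rule minimal_model_embedding[OF E mm]) (rule that)
  have cW: "card (pverts F) = card W" using F(2) by (rule bij_betw_same_card)
  have "simple_graph F" using F(1,2) assms(5) by (auto simp: simple_graph_def bij_betw_def)
  moreover have "avg_degree F = 2 * card R / card W" using cW arcs by (simp add: avg_degree_def)
  moreover have "k_subdivision j F = subdivided F s"
    unfolding k_subdivision_def using s j by (intro subdivided_cong) simp
  moreover have "contains_induced_subgraph G (subdivided F s)"
  proof (rule contains_subgraphI(2)[OF _ _ g(1) _ g(3)])
    interpret S: pair_graph "subdivided F s" using F(1) by (rule pair_graph_subdivided)
    show "pair_wf_digraph (subdivided F s)" by (rule S.pair_wf_digraph)
    show "g ` pverts (subdivided F s) \<subseteq> pverts G"
      using g(2) assms(4) IG by blast
  qed (use g(4)[OF m] G.pair_wf_digraph in auto)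
  ultimately show ?thesis by (intro exI[of _ F]) simp
qed

section \<open>From subdivisions to models\<close>

lemma embedded_subdivision_model:
  fixes F :: "nat pair_pre_digraph"
  assumes F: "pair_graph F" and E: "sym E" and s: "\<And>e. e \<in> edge_reps F \<Longrightarrow> s e \<le> L"
    and g: "inj_on g (pverts (subdivided F s))"
      "\<And>x y. (x, y) \<in> parcs (subdivided F s) \<Longrightarrow> (g x, g y) \<in> E"
  shows "\<exists>I. topological_model E ((g \<circ> Inl) ` pverts F) ((\<lambda>(a, b). {g (Inl a), g (Inl b)}) ` parcs F) I L \<and>
    \<Union> (I ` (\<lambda>(a, b). {g (Inl a), g (Inl b)}) ` parcs F) \<subseteq> g ` pverts (subdivided F s)"
proof -
  interpret F: pair_graph F by fact
  define \<sigma> where "\<sigma> = g \<circ> Inl"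
  have vert: "Inl a \<in> pverts (subdivided F s)" if "a \<in> pverts F" for a
    using that by (simp add: subdivided_def)
  have inner: "Inr (e, i) \<in> pverts (subdivided F s)" if "e \<in> edge_reps F" "1 \<le> i" "i \<le> s e" for e i
    using that by (cases e) (simp add: subdivided_def)
  have ginj: "x = y" if "g x = g y" "x \<in> pverts (subdivided F s)" "y \<in> pverts (subdivided F s)" for x y
    using that g(1) by (auto dest: inj_onD)
  have \<sigma>i: "\<sigma> a = \<sigma> b \<longleftrightarrow> a = b" if "a \<in> pverts F" "b \<in> pverts F" for a b
    using ginj[of "Inl a" "Inl b"] vert that by (auto simp: \<sigma>_def)
  define r where "r = (\<lambda>e. {\<sigma> (fst e), \<sigma> (snd e)})"
  have rep: "fst e \<in> pverts F" "snd e \<in> pverts F" "fst e < snd e" "e \<in> parcs F" if "e \<in> edge_reps F" for e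
    using that F.arc_fst_in_verts F.arc_snd_in_verts by (auto simp: edge_reps_def)
  have rinj: "e = f" if "e \<in> edge_reps F" "f \<in> edge_reps F" "r e = r f" for e f
    using rep[OF that(1)] rep[OF that(2)] that(3)
    by (auto simp: r_def doubleton_eq_iff \<sigma>i intro: prod_eqI)
  define R where "R = (\<lambda>(a, b). {g (Inl a), g (Inl b)}) ` parcs F"
  have Rr: "\<exists>e\<in>edge_reps F. q = r e" if q: "q \<in> R" for q
  proof -
    obtain a b where ab: "(a, b) \<in> parcs F" "q = {\<sigma> a, \<sigma> b}" using q by (auto simp: R_def \<sigma>_def)
    have "q = r (a, b)" "q = r (b, a)" using ab(2) by (auto simp: r_def)
    then show ?thesis using edge_reps_cases[OF F ab(1)] by metis
  qed
  \<comment> \<open>Inner sets are indexed by unordered pairs of branch images; by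
    \<open>rinj\<close> only one increasing arc contributes to each.\<close>
  define I where "I = (\<lambda>q. {g (Inr (e, i)) | e i. e \<in> edge_reps F \<and> r e = q \<and> 1 \<le> i \<and> i \<le> s e})"
  have I: "I (r e) = (\<lambda>i. g (Inr (e, i))) ` {1..s e}" if "e \<in> edge_reps F" for e
  proof (intro equalityI subsetI)
    fix x assume "x \<in> I (r e)"
    then obtain f i where f: "x = g (Inr (f, i))" "f \<in> edge_reps F" "r f = r e" "1 \<le> i" "i \<le> s f"
      unfolding I_def by blast
    then show "x \<in> (\<lambda>i. g (Inr (e, i))) ` {1..s e}" using rinj[OF f(2) that f(3)] by auto
  next
    fix x assume "x \<in> (\<lambda>i. g (Inr (e, i))) ` {1..s e}"
    then obtain i where "x = g (Inr (e, i))" "1 \<le> i" "i \<le> s e" by auto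
    then show "x \<in> I (r e)" unfolding I_def using that by blast
  qed
  have lnk: "linked E (I (r e)) (\<sigma> (fst e)) (\<sigma> (snd e))" if e: "e \<in> edge_reps F" for e
  proof -
    have "walk_via E (I (r e)) (\<lambda>i. g (sd_vertex s e i)) (Suc (s e))"
      unfolding walk_via_def
    proof (intro conjI allI impI)
      fix i assume "i < Suc (s e)"
      then have "(sd_vertex s e i, sd_vertex s e (Suc i)) \<in> parcs (subdivided F s)"
        using sd_arcs_subdivided[where s = s, OF e] by simp
      then show "(g (sd_vertex s e i), g (sd_vertex s e (Suc i))) \<in> E" by (rule g(2))
    next
      fix i assume "0 < i \<and> i < Suc (s e)"
      then show "g (sd_vertex s e i) \<in> I (r e)" unfolding I[OF e] by (auto simp: sd_vertex_def)
    qed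
    then show ?thesis unfolding linked_def
      by (intro exI[of _ "\<lambda>i. g (sd_vertex s e i)"] exI[of _ "Suc (s e)"])
        (auto simp: sd_vertex_def \<sigma>_def)
  qed
  have "topological_model E (\<sigma> ` pverts F) R I L"
    unfolding topological_model_def
  proof (intro conjI allI impI ballI)
    show "finite (\<sigma> ` pverts F)" using F.pair_finite_verts by simp
    show "R \<subseteq> nsets (\<sigma> ` pverts F) 2"
    proof
      fix q assume "q \<in> R"
      then obtain e where e: "e \<in> edge_reps F" "q = r e" using Rr by blast
      then show "q \<in> nsets (\<sigma> ` pverts F) 2" using rep(1-3)[OF e(1)] \<sigma>i by (simp add: r_def)
    qed
    show "linked E (I {u, v}) u v" if uv: "{u, v} \<in> R" for u v
    proof -
      obtain e where e: "e \<in> edge_reps F" "{u, v} = r e" using Rr[OF uv] by blast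
      then have "u = \<sigma> (fst e) \<and> v = \<sigma> (snd e) \<or> u = \<sigma> (snd e) \<and> v = \<sigma> (fst e)"
        by (auto simp: r_def doubleton_eq_iff)
      then show ?thesis using lnk[OF e(1)] linked_sym[OF E] e(2) by auto
    qed
    fix q assume "q \<in> R"
    then obtain e where e: "e \<in> edge_reps F" "q = r e" using Rr by blast
    show "finite (I q)" using I e by simp
    have "card (I q) \<le> card {1..s e}" unfolding e(2) I[OF e(1)] by (rule card_image_le) simp
    then show "card (I q) \<le> L" using s[OF e(1)] by simp
    show "I q \<inter> \<sigma> ` pverts F = {}"
      unfolding e(2) I[OF e(1)] using ginj[OF _ inner[OF e(1)] vert] by (auto simp: \<sigma>_def)
  next
    show "disjoint_family_on I R"
      unfolding disjoint_family_on_def I_def using ginj[OF _ inner inner] by blast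
  qed
  moreover have "\<Union> (I ` R) \<subseteq> g ` pverts (subdivided F s)"
    unfolding I_def using inner by blast
  ultimately show ?thesis unfolding R_def \<sigma>_def by blast
qed

section \<open>Induced models in sparse graphs\<close>

text \<open>The number of ordered pairs in \<open>C \<inter> X \<times> X\<close> is a degree sum,
  so every nonempty subset has a vertex of degree at most \<open>D\<close>. Taking it and discarding
  its neighbours uses up at most \<open>D + 1\<close> vertices per chosen one.\<close>

lemma degenerate_independent_set:
  fixes D :: real
  assumes "finite V" "sym C" "\<And>x. (x, x) \<notin> C" "0 \<le> D"
    and "\<And>X. X \<subseteq> V \<Longrightarrow> card (C \<inter> X \<times> X) \<le> D * card X"
  shows "\<exists>S\<subseteq>V. (\<forall>x\<in>S. \<forall>y\<in>S. (x, y) \<notin> C) \<and> card V \<le> (D + 1) * card S"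
  using assms(1,5)
proof (induction V rule: finite_psubset_induct)
  case (psubset V)
  show ?case
  proof (cases "V = {}")
    case False
    define N where "N = (\<lambda>v. {y \<in> V. (v, y) \<in> C})"
    have "C \<inter> V \<times> V = (SIGMA v:V. N v)" by (auto simp: N_def)
    then have sum: "card (C \<inter> V \<times> V) = (\<Sum>v\<in>V. card (N v))"
      using psubset.hyps by (simp add: N_def)
    have "\<exists>v\<in>V. card (N v) \<le> D"
    proof (rule ccontr)
      assume "\<not> ?thesis"
      then have "(\<Sum>v\<in>V. D) < (\<Sum>v\<in>V. real (card (N v)))"
        using psubset.hyps False by (intro sum_strict_mono) auto
      then show False using psubset.prems[of V] sum by (simp add: mult.commute)
    qed
    then obtain v where v: "v \<in> V" "card (N v) \<le> D" by blast
    define V' where "V' = V - insert v (N v)"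
    have "V' \<subset> V" using v by (auto simp: V'_def)
    then obtain S where S: "S \<subseteq> V'" "\<forall>x\<in>S. \<forall>y\<in>S. (x, y) \<notin> C" "card V' \<le> (D + 1) * card S"
      using psubset.IH[of V'] psubset.prems by blast
    have finS: "finite S" using S(1) \<open>V' \<subset> V\<close> psubset.hyps by (meson finite_subset psubset_imp_subset)
    have "v \<notin> S" using S(1) by (auto simp: V'_def)
    have "(v, y) \<notin> C \<and> (y, v) \<notin> C" if "y \<in> S" for y
      using that S(1) assms(2) by (auto simp: V'_def N_def dest: symD)
    then have "\<forall>x\<in>insert v S. \<forall>y\<in>insert v S. (x, y) \<notin> C" using S(2) assms(3) by blast
    moreover have "insert v S \<subseteq> V" using S(1) v by (auto simp: V'_def)
    moreover have "real (card V) \<le> (D + 1) * card (insert v S)"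
    proof -
      have "V = V' \<union> insert v (N v)" using v by (auto simp: V'_def N_def)
      then have "card V \<le> card V' + card (insert v (N v))" by (metis card_Un_le)
      moreover have "card (insert v (N v)) \<le> Suc (card (N v))" by (rule card_insert_le_m1) auto
      ultimately have "card V \<le> card V' + Suc (card (N v))" by linarith
      then have "real (card V) \<le> card V' + (1 + D)" using v(2) by linarith
      then show ?thesis using S(3) finS \<open>v \<notin> S\<close> by (simp add: algebra_simps)
    qed
    ultimately show ?thesis by blast
  qed auto
qed

text \<open>
  The sum is the expected number of indices selected by a random set containing every element
  independently with probability \<open>p\<close>. The proof fixes the elements one by one, without decreasing
  the conditional expectation.
\<close>

lemma random_selection:
  fixes p :: real and V :: "'b set" and A B :: "'e \<Rightarrow> 'b set"
  assumes "finite V" "finite R" "0 \<le> p" "p \<le> 1"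
    and "\<And>e. e \<in> R \<Longrightarrow> A e \<subseteq> V \<and> B e \<subseteq> V \<and> A e \<inter> B e = {}"
  shows "\<exists>X\<subseteq>V. (\<Sum>e\<in>R. p ^ card (A e) * (1 - p) ^ card (B e)) \<le> card {e \<in> R. A e \<subseteq> X \<and> B e \<inter> X = {}}"
  using assms(1,2,5)
proof (induction V arbitrary: R A B rule: finite_induct)
  case empty
  then have "{e \<in> R. A e \<subseteq> {} \<and> B e \<inter> {} = {}} = R" by auto
  moreover have "(\<Sum>e\<in>R. p ^ card (A e) * (1 - p) ^ card (B e)) = (\<Sum>e\<in>R. 1)"
    using empty.prems by (intro sum.cong) auto
  ultimately show ?case by (intro exI[of _ "{}"]) simp
next
  case (insert v V)
  define w where "w = (\<lambda>(A :: 'e \<Rightarrow> 'b set) (B :: 'e \<Rightarrow> 'b set) e. p ^ card (A e) * (1 - p) ^ card (B e))"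
  \<comment> \<open>\<open>R1\<close> and \<open>R0\<close> collect the indices still possible once
    \<open>v\<close> is selected or rejected. By \<open>split\<close>, the expectation is the convex
    combination, with weights \<open>p\<close> and \<open>1 - p\<close>, of the two conditional
    ones, so the better of the two cases attains it.\<close>
  define R1 where "R1 = {e \<in> R. v \<notin> B e}"
  define R0 where "R0 = {e \<in> R. v \<notin> A e}"
  define A' where "A' = (\<lambda>e. A e - {v})"
  define B' where "B' = (\<lambda>e. B e - {v})"
  have fin: "finite R1" "finite R0" using insert.prems by (auto simp: R1_def R0_def)
  have AB: "A e \<subseteq> insert v V" "B e \<subseteq> insert v V" "A e \<inter> B e = {}" if "e \<in> R" for e
    using insert.prems(2)[OF that] by auto
  have AB1: "A' e \<subseteq> V \<and> B e \<subseteq> V \<and> A' e \<inter> B e = {}" if "e \<in> R1" for e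
    using that AB[of e] by (auto simp: R1_def A'_def)
  have "\<exists>X\<subseteq>V. (\<Sum>e\<in>R1. w A' B e) \<le> card {e \<in> R1. A' e \<subseteq> X \<and> B e \<inter> X = {}}"
    unfolding w_def by (rule insert.IH[OF fin(1) AB1])
  then obtain X1 where X1: "X1 \<subseteq> V"
    "(\<Sum>e\<in>R1. w A' B e) \<le> card {e \<in> R1. A' e \<subseteq> X1 \<and> B e \<inter> X1 = {}}" by blast
  have AB0: "A e \<subseteq> V \<and> B' e \<subseteq> V \<and> A e \<inter> B' e = {}" if "e \<in> R0" for e
    using that AB[of e] by (auto simp: R0_def B'_def)
  have "\<exists>X\<subseteq>V. (\<Sum>e\<in>R0. w A B' e) \<le> card {e \<in> R0. A e \<subseteq> X \<and> B' e \<inter> X = {}}"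
    unfolding w_def by (rule insert.IH[OF fin(2) AB0])
  then obtain X0 where X0: "X0 \<subseteq> V"
    "(\<Sum>e\<in>R0. w A B' e) \<le> card {e \<in> R0. A e \<subseteq> X0 \<and> B' e \<inter> X0 = {}}" by blast
  have sel1: "{e \<in> R1. A' e \<subseteq> X1 \<and> B e \<inter> X1 = {}}
      = {e \<in> R. A e \<subseteq> insert v X1 \<and> B e \<inter> insert v X1 = {}}"
    unfolding R1_def A'_def by blast
  have sel0: "{e \<in> R0. A e \<subseteq> X0 \<and> B' e \<inter> X0 = {}} = {e \<in> R. A e \<subseteq> X0 \<and> B e \<inter> X0 = {}}"
    using X0(1) insert.hyps(2) unfolding R0_def B'_def by blast
  have split: "w A B e = (if v \<notin> B e then p * w A' B e else 0) + (if v \<notin> A e then (1 - p) * w A B' e else 0)"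
    if e: "e \<in> R" for e
  proof -
    have fe: "finite (A e)" "finite (B e)"
      using finite_subset[OF AB(1)[OF e]] finite_subset[OF AB(2)[OF e]] insert.hyps(1) by simp_all
    have cA: "card (A e) = Suc (card (A' e))" if "v \<in> A e"
      unfolding A'_def by (rule card_Suc_Diff1[OF fe(1) that, symmetric])
    have cB: "card (B e) = Suc (card (B' e))" if "v \<in> B e"
      unfolding B'_def by (rule card_Suc_Diff1[OF fe(2) that, symmetric])
    have nA: "A' e = A e" if "v \<notin> A e" using that by (simp add: A'_def)
    have nB: "B' e = B e" if "v \<notin> B e" using that by (simp add: B'_def)
    consider "v \<in> A e" "v \<notin> B e" | "v \<notin> A e" "v \<in> B e" | "v \<notin> A e" "v \<notin> B e"
      using AB(3)[OF e] by blast
    then show ?thesis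
    proof cases
      case 1 then show ?thesis by (simp add: w_def cA)
    next
      case 2 then show ?thesis by (simp add: w_def cB)
    next
      case 3 then show ?thesis by (simp add: w_def nA nB algebra_simps)
    qed
  qed
  have "(\<Sum>e\<in>R. w A B e) = (\<Sum>e\<in>R. if v \<notin> B e then p * w A' B e else 0)
      + (\<Sum>e\<in>R. if v \<notin> A e then (1 - p) * w A B' e else 0)"
    unfolding sum.distrib[symmetric] by (intro sum.cong refl split)
  also have "\<dots> = p * (\<Sum>e\<in>R1. w A' B e) + (1 - p) * (\<Sum>e\<in>R0. w A B' e)"
    unfolding R1_def R0_def sum.inter_filter[OF insert.prems(1)] sum_distrib_left
    by (intro arg_cong2[where f = "(+)"] sum.cong) auto
  also have "\<dots> \<le> p * card {e \<in> R. A e \<subseteq> insert v X1 \<and> B e \<inter> insert v X1 = {}}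
      + (1 - p) * card {e \<in> R. A e \<subseteq> X0 \<and> B e \<inter> X0 = {}}" (is "_ \<le> p * ?a + (1 - p) * ?b")
    using X1(2) X0(2) assms(3,4) unfolding sel1 sel0 by (intro add_mono mult_left_mono) auto
  also have "\<dots> \<le> max ?a ?b"
    using assms(3,4) by (intro convex_bound_le) auto
  finally have "(\<Sum>e\<in>R. w A B e) \<le> ?a \<or> (\<Sum>e\<in>R. w A B e) \<le> ?b" by linarith
  then show ?case
  proof
    assume "(\<Sum>e\<in>R. w A B e) \<le> ?a"
    then show ?thesis using X1(1) unfolding w_def by (intro exI[of _ "insert v X1"]) auto
  next
    assume "(\<Sum>e\<in>R. w A B e) \<le> ?b"
    then show ?thesis using X0(1) unfolding w_def by (intro exI[of _ X0]) auto
  qed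
qed

text \<open>
  From the model keep in turn: an independent set \<open>S\<close> of branch vertices; minimal, hence induced,
  paths; the most frequent path length; a set \<open>R1\<close> of paths with no edge between two of them; and a
  random set \<open>X\<close> of branch vertices that avoids the remaining unwanted edges. Each step loses only a
  factor polynomial in \<open>D\<close>.
\<close>

lemma clique_model_order_bound:
  fixes D :: real
  assumes "finite E" "sym E" "\<And>x. (x, x) \<notin> E" "1 \<le> D"
    and m: "topological_model E W (nsets W 2) I k"
    and Y: "W \<union> \<Union> (I ` nsets W 2) \<subseteq> Y" "finite Y"
    and H: "\<And>X Q J j. X \<subseteq> Y \<Longrightarrow> X \<noteq> {} \<Longrightarrow> j \<le> k \<Longrightarrow> induced_model E X Q J k \<Longrightarrow>
      (\<forall>e\<in>Q. card (J e) = j) \<Longrightarrow> 2 * card Q \<le> D * card X"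
  shows "card W \<le> 18 * D ^ 5 * (real k + 1) ^ 4"
proof -
  \<comment> \<open>All edges inside \<open>X\<close>, with empty inner sets, form an induced model,
    to which \<open>H\<close> applies with \<open>j = 0\<close>.\<close>
  have sparse: "card (E \<inter> X \<times> X) \<le> D * card X" if X: "X \<subseteq> Y" for X
  proof (cases "X = {}")
    case False
    define A where "A = E \<inter> X \<times> X"
    define Q where "Q = (\<lambda>(a, b). {a, b}) ` A"
    have finX: "finite X" using X Y(2) by (rule finite_subset)
    have EQ: "(u, v) \<in> E" if "{u, v} \<in> Q" for u v
      using that assms(2,3) by (auto simp: Q_def A_def doubleton_eq_iff dest: symD)
    have "topological_model E X Q (\<lambda>_. {}) k"
      unfolding topological_model_def
    proof (intro conjI)
      show "Q \<subseteq> nsets X 2" using assms(3) by (auto simp: Q_def A_def)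
      show "\<forall>u v. {u, v} \<in> Q \<longrightarrow> linked E {} u v" by (intro allI impI linked_arc EQ)
    qed (use finX in \<open>auto simp: disjoint_family_on_def\<close>)
    moreover have "{u, v} \<in> Q" if "u \<in> X" "v \<in> X" "(u, v) \<in> E" for u v
      unfolding Q_def A_def by (rule image_eqI[of _ _ "(u, v)"]) (use that in auto)
    ultimately have "induced_model E X Q (\<lambda>_. {}) k"
      by (simp add: induced_model_def minimal_model_def)
    then have "2 * card Q \<le> D * card X" using H[OF X False, of 0] by simp
    moreover have "card A = 2 * card ((\<lambda>(a, b). {id a, id b}) ` A)"
    proof (rule card_sym_arcs)
      show "sym A" using assms(2) by (auto simp: A_def sym_def)
    qed (use assms(1,3) in \<open>auto simp: A_def\<close>)
    ultimately show ?thesis by (simp add: A_def Q_def)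
  qed simp
  note mD = topological_modelD[OF m]
  obtain S where S: "S \<subseteq> W" "\<forall>x\<in>S. \<forall>y\<in>S. (x, y) \<notin> E" "card W \<le> (D + 1) * card S"
  proof -
    have "card (E \<inter> X \<times> X) \<le> D * card X" if "X \<subseteq> W" for X using sparse[of X] that Y(1) by auto
    from degenerate_independent_set[OF mD(1) assms(2,3) _ this] show ?thesis
      using assms(4) that by auto
  qed
  have finS: "finite S" using S(1) mD(1) by (rule finite_subset)
  have k1: "(real k + 1) ^ n \<ge> 1" for n by simp
  have D1: "D ^ n \<ge> 1" for n using assms(4) by simp
  have "card S \<le> 9 * D ^ 4 * (real k + 1) ^ 4"
  proof (cases "card S \<le> 1")
    case True
    have "1 \<le> D ^ 4 * (real k + 1) ^ 4" using mult_mono[OF D1[of 4] k1[of 4]] D1[of 4] by simp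
    then show ?thesis using True by linarith
  next
    case False
    have mS: "topological_model E S (nsets S 2) I k"
      by (rule topological_model_mono[OF m S(1) nsets_mono[OF S(1)]]) auto
    obtain J where J: "minimal_model E S (nsets S 2) J k" "\<And>e. e \<in> nsets S 2 \<Longrightarrow> J e \<subseteq> I e \<inter> Field E"
      using minimal_model_exists[OF assms(2) mS] by blast
    have mJ: "topological_model E S (nsets S 2) J k" using J(1) by (simp add: minimal_model_def)
    note JD = topological_modelD[OF mJ]
    have JY: "J e \<subseteq> Y" if "e \<in> nsets S 2" for e
      using J(2)[OF that] Y(1) that nsets_mono[OF S(1)] by blast
    \<comment> \<open>As \<open>S\<close> is independent, no inner set is empty. The sizes thus lie
      in \<open>{1..k}\<close>, and the pigeonhole principle costs a factor \<open>k\<close>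
      only.\<close>
    have J1: "1 \<le> card (J e)" if e: "e \<in> nsets S 2" for e
    proof (rule ccontr)
      assume "\<not> 1 \<le> card (J e)"
      then have "J e = {}" using JD(6)[OF e] by (simp add: Suc_le_eq card_gt_0_iff)
      moreover obtain u v where uv: "e = {u, v}" "u \<in> S" "v \<in> S" "u \<noteq> v"
        using e unfolding nsets_2_eq by blast
      ultimately have "(u, v) \<in> E" using JD(4)[of u v] e linked_empty by metis
      then show False using S(2) uv by blast
    qed
    define P where "P = (\<lambda>j. {e \<in> nsets S 2. card (J e) = j})"
    have finP: "finite (P j)" for j using JD(3) by (simp add: P_def)
    have "\<exists>j\<in>{1..k}. card (nsets S 2) \<le> k * card (P j)"
    proof (rule ccontr)
      assume neg: "\<not> ?thesis"
      have "nsets S 2 = (\<Union>j\<in>{1..k}. P j)" using J1 JD(7) by (auto simp: P_def)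
      then have "card (nsets S 2) \<le> (\<Sum>j\<in>{1..k}. card (P j))" by (metis card_UN_le finite_atLeastAtMost)
      then have "k * card (nsets S 2) \<le> (\<Sum>j\<in>{1..k}. k * card (P j))"
        by (metis mult_le_mono2 sum_distrib_left)
      moreover have "card (nsets S 2) \<noteq> 0" using False by (auto simp: card_nsets)
      then have k: "k \<noteq> 0" using \<open>card (nsets S 2) \<le> _\<close> by (cases k) auto
      then have "(\<Sum>j\<in>{1..k}. k * card (P j)) < (\<Sum>j\<in>{1..k}. card (nsets S 2))"
        using neg by (intro sum_strict_mono) (auto simp: not_le)
      ultimately show False by simp
    qed
    then obtain j where j: "1 \<le> j" "j \<le> k" "card (nsets S 2) \<le> k * card (P j)" by auto
    have PD: "e \<in> nsets S 2" "card (J e) = j" if "e \<in> P j" for e using that by (auto simp: P_def)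
    define owner where "owner = (\<lambda>x. THE e. e \<in> nsets S 2 \<and> x \<in> J e)"
    have owner: "owner x = e" if "e \<in> nsets S 2" "x \<in> J e" for e x
      unfolding owner_def using that JD(10) by (intro the_equality) auto
    have UY: "\<Union> (J ` Q) \<subseteq> Y" if "Q \<subseteq> P j" for Q using JY PD(1) that by blast
    have cU: "card (\<Union> (J ` Q)) \<le> k * card Q" if Q: "Q \<subseteq> P j" for Q
    proof -
      have "finite Q" using Q finP by (rule finite_subset)
      then have "card (\<Union> (J ` Q)) \<le> (\<Sum>e\<in>Q. card (J e))" by (rule card_UN_le)
      also have "\<dots> \<le> (\<Sum>e\<in>Q. k)" using PD(2) Q j(2) by (intro sum_mono) auto
      finally show ?thesis by (simp add: mult.commute)
    qed
    \<comment> \<open>\<open>C\<close> is the conflict graph of the paths. Inner sets are disjoint,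
      so \<open>owner\<close> sends arcs inside their union to pairs covering all conflicts; the
      inner sets of \<open>Q\<close> have at most \<open>k * card Q\<close> vertices in all, so
      \<open>C\<close> inherits sparseness with constant \<open>D * k\<close>.\<close>
    define C where "C = {(e, f). e \<in> P j \<and> f \<in> P j \<and> e \<noteq> f \<and> (\<exists>x\<in>J e. \<exists>y\<in>J f. (x, y) \<in> E)}"
    have "card (C \<inter> Q \<times> Q) \<le> (D * k) * card Q" if Q: "Q \<subseteq> P j" for Q
    proof -
      let ?U = "\<Union> (J ` Q)"
      have "C \<inter> Q \<times> Q \<subseteq> (\<lambda>(x, y). (owner x, owner y)) ` (E \<inter> ?U \<times> ?U)"
      proof
        fix c assume "c \<in> C \<inter> Q \<times> Q"
        then obtain e f x y where c: "c = (e, f)" "e \<in> Q" "f \<in> Q" "x \<in> J e" "y \<in> J f" "(x, y) \<in> E"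
          unfolding C_def by blast
        then have "owner x = e" "owner y = f" using owner PD(1) Q by blast+
        then show "c \<in> (\<lambda>(x, y). (owner x, owner y)) ` (E \<inter> ?U \<times> ?U)"
          using c by (intro image_eqI[of _ _ "(x, y)"]) auto
      qed
      then have "card (C \<inter> Q \<times> Q) \<le> card (E \<inter> ?U \<times> ?U)"
        using assms(1) by (meson card_image_le card_mono finite_Int finite_imageI le_trans)
      also have "real \<dots> \<le> D * card ?U" by (rule sparse[OF UY[OF Q]])
      also have "\<dots> \<le> D * real (k * card Q)" using assms(4) by (intro mult_left_mono of_nat_mono cU[OF Q]) auto
      finally show ?thesis by simp
    qed
    moreover have "sym C"
    proof (rule symI)
      fix e f assume "(e, f) \<in> C"
      then obtain x y where "e \<in> P j" "f \<in> P j" "e \<noteq> f" "x \<in> J e" "y \<in> J f" "(x, y) \<in> E"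
        unfolding C_def by blast
      moreover from this have "(y, x) \<in> E" using assms(2) by (blast dest: symD)
      ultimately show "(f, e) \<in> C" unfolding C_def by blast
    qed
    moreover have "(x, x) \<notin> C" for x by (simp add: C_def)
    ultimately obtain R1 where R1: "R1 \<subseteq> P j" "\<forall>e\<in>R1. \<forall>f\<in>R1. (e, f) \<notin> C"
      "card (P j) \<le> (D * k + 1) * card R1"
      using degenerate_independent_set[OF finP, of C "D * k" j] assms(4) by auto
    have finR1: "finite R1" using R1(1) finP by (rule finite_subset)
    \<comment> \<open>\<open>B e\<close> holds the branch vertices that must stay out of
      \<open>X\<close> if \<open>e\<close> is to be kept: adjacent to its path but not among its
      ends.\<close>
    define B where "B = (\<lambda>e. {w \<in> S - e. \<exists>x\<in>J e. (x, w) \<in> E})"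
    have sumB: "(\<Sum>e\<in>R1. real (card (B e))) \<le> D * (card S + k * card R1)"
    proof -
      let ?U = "S \<union> \<Union> (J ` R1)"
      have "(SIGMA e:R1. B e) \<subseteq> (\<lambda>(x, w). (owner x, w)) ` (E \<inter> ?U \<times> ?U)"
      proof
        fix c assume "c \<in> (SIGMA e:R1. B e)"
        then obtain e w x where c: "c = (e, w)" "e \<in> R1" "w \<in> S" "x \<in> J e" "(x, w) \<in> E"
          unfolding B_def by blast
        then have "owner x = e" using owner PD(1) R1(1) by blast
        then show "c \<in> (\<lambda>(x, w). (owner x, w)) ` (E \<inter> ?U \<times> ?U)"
          using c by (intro image_eqI[of _ _ "(x, w)"]) auto
      qed
      then have "card (SIGMA e:R1. B e) \<le> card (E \<inter> ?U \<times> ?U)"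
        using assms(1) by (meson card_image_le card_mono finite_Int finite_imageI le_trans)
      then have "real (card (SIGMA e:R1. B e)) \<le> real (card (E \<inter> ?U \<times> ?U))" by simp
      moreover have "(\<Sum>e\<in>R1. real (card (B e))) = real (card (SIGMA e:R1. B e))"
        using finR1 finS by (simp add: B_def)
      moreover have "card (E \<inter> ?U \<times> ?U) \<le> D * card ?U"
        using sparse[of ?U] UY[OF R1(1)] S(1) Y(1) by blast
      moreover have "card ?U \<le> card S + k * card R1"
        using card_Un_le[of S "\<Union> (J ` R1)"] cU[OF R1(1)] by linarith
      then have "D * card ?U \<le> D * real (card S + k * card R1)"
        using assms(4) by (intro mult_left_mono of_nat_mono) auto
      ultimately show ?thesis by linarith
    qed
    define K where "K = real k + 1"
    have K: "K \<ge> 1" by (simp add: K_def)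
    \<comment> \<open>If \<open>card R1 \<ge> card S\<close>, then by \<open>sumB\<close> the sizes
      of all \<open>B e\<close> sum to at most \<open>D * K * card R1\<close>. This \<open>p\<close>
      makes the expected loss at most half of the main term.\<close>
    define p where "p = 1 / (2 * D * K)"
    have p: "0 < p" "p \<le> 1"
      using assms(4) K mult_mono[of 1 D 1 K] by (auto simp: p_def field_simps)
    have eD: "e \<subseteq> S" "card e = 2" if "e \<in> R1" for e
      using PD(1) R1(1) that by (auto simp: nsets_def)
    obtain X where X: "X \<subseteq> S"
      "(\<Sum>e\<in>R1. p ^ card e * (1 - p) ^ card (B e)) \<le> card {e \<in> R1. e \<subseteq> X \<and> B e \<inter> X = {}}"
      using random_selection[OF finS finR1, of p "\<lambda>e. e" B] p eD by (auto simp: B_def)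
    define Q where "Q = {e \<in> R1. e \<subseteq> X \<and> B e \<inter> X = {}}"
    have Q: "Q \<subseteq> nsets S 2" "Q \<subseteq> nsets X 2" "Q \<subseteq> R1"
      using PD(1) R1(1) by (auto simp: Q_def nsets_def)
    have "minimal_model E X Q J k"
      unfolding minimal_model_def
    proof (intro conjI allI impI)
      show "topological_model E X Q J k" using mJ X(1) Q(1,2) by (rule topological_model_mono) simp
      show "\<not> linked E T u v" if "{u, v} \<in> Q" "T \<subset> J {u, v}" for u v T
        using J(1) subsetD[OF Q(1) that(1)] that(2) unfolding minimal_model_def by blast
    qed
    then have "induced_model E X Q J k"
      unfolding induced_model_def
    proof (intro conjI allI impI)
      show "{u, v} \<in> Q" if "u \<in> X" "v \<in> X" "(u, v) \<in> E" for u v using that S(2) X(1) by blast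
      show "w \<in> e" if "e \<in> Q" "x \<in> J e" "w \<in> X" "(x, w) \<in> E" for e x w
        using that X(1) unfolding Q_def B_def by blast
      show "e = f" if "e \<in> Q" "f \<in> Q" "x \<in> J e" "y \<in> J f" "(x, y) \<in> E" for e f x y
        using that R1(1,2) Q(3) unfolding C_def by blast
    qed
    moreover have "\<forall>e\<in>Q. card (J e) = j" using PD(2) Q(3) R1(1) by blast
    moreover have "Q = {}" if "X = {}" using Q(2) that by (auto simp: nsets_def)
    ultimately have "2 * real (card Q) \<le> D * card X"
      using H[of X j Q J] j(2) X(1) S(1) Y(1) by (cases "X = {}") auto
    also have "\<dots> \<le> D * card S"
      using card_mono[OF finS X(1)] assms(4) by (intro mult_left_mono) auto
    finally have Q1: "2 * real (card Q) \<le> D * card S" .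
    \<comment> \<open>An edge survives if both ends are selected and \<open>B e\<close> is missed;
      Bernoulli's inequality makes its probability linear in \<open>card (B e)\<close>, so that only
      the sum matters.\<close>
    have "p ^ 2 * (card R1 - p * (\<Sum>e\<in>R1. real (card (B e)))) = (\<Sum>e\<in>R1. p ^ 2 * (1 - card (B e) * p))"
      by (simp add: sum_distrib_left sum_subtractf algebra_simps)
    also have "\<dots> \<le> (\<Sum>e\<in>R1. p ^ card e * (1 - p) ^ card (B e))"
    proof (rule sum_mono)
      fix e assume "e \<in> R1"
      then show "p ^ 2 * (1 - card (B e) * p) \<le> p ^ card e * (1 - p) ^ card (B e)"
        using eD(2) Bernoulli_inequality[of "- p" "card (B e)"] p by (auto intro!: mult_left_mono)
    qed
    also have "\<dots> \<le> card Q" using X(2) by (simp add: Q_def)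
    finally have Q2: "p ^ 2 * (card R1 - p * (\<Sum>e\<in>R1. real (card (B e)))) \<le> card Q" .
    have "2 * card (nsets S 2) = card S * (card S - 1)"
    proof -
      have "even (card S * (card S - 1))" by (cases "even (card S)") auto
      then show ?thesis by (simp add: card_nsets choose_two)
    qed
    then have "card S * (card S - 1) \<le> 2 * (k * card (P j))" using j(3) by linarith
    then have "real (card S * (card S - 1)) \<le> real (2 * (k * card (P j)))" by (simp only: of_nat_le_iff)
    then have "card S * (real (card S) - 1) \<le> 2 * k * real (card (P j))" using False by (simp add: of_nat_diff)
    also have "\<dots> \<le> 2 * k * ((D * k + 1) * card R1)" using R1(3) by (intro mult_left_mono) auto
    also have "\<dots> \<le> 2 * (real k + 1) * ((D * (real k + 1)) * card R1)"
      using assms(4) by (intro mult_mono) (auto simp: algebra_simps)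
    also have "\<dots> = 2 * D * (real k + 1) ^ 2 * card R1" by (simp add: power2_eq_square)
    finally have S1: "card S * (real (card S) - 1) \<le> 2 * D * (real k + 1) ^ 2 * card R1" .
    have Spos: "real (card S) > 0" using False by simp
    \<comment> \<open>For \<open>card R1 < card S\<close> the estimate \<open>S1\<close> suffices.
      Otherwise \<open>p ^ 2 * card R1 / 2 \<le> card Q \<le> D * card S / 2\<close>, so
      \<open>card R1 \<le> 4 * D ^ 3 * K ^ 2 * card S\<close>, and \<open>S1\<close> contributes the
      factor \<open>2 * D * K ^ 2\<close>.\<close>
    have "real (card S) - 1 \<le> 8 * D ^ 4 * K ^ 4"
    proof (cases "card R1 < card S")
      case True
      then have "card S * (real (card S) - 1) \<le> 2 * D * K ^ 2 * card S"
        using S1 assms(4) unfolding K_def[symmetric] by (smt (verit) mult_left_mono of_nat_less_iff zero_le_power2 mult_nonneg_nonneg)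
      then have "real (card S) - 1 \<le> 2 * D * K ^ 2" using Spos by (simp add: mult.commute)
      also have "\<dots> \<le> 8 * D ^ 4 * K ^ 4"
        using assms(4) K by (intro mult_mono power_increasing self_le_power) auto
      finally show ?thesis .
    next
      case False
      then have "D * (card S + k * card R1) \<le> D * (K * card R1)"
        using assms(4) by (intro mult_left_mono) (auto simp: K_def algebra_simps)
      then have "p * (\<Sum>e\<in>R1. real (card (B e))) \<le> p * (D * (K * card R1))"
        using sumB p(1) by (intro mult_left_mono) auto
      also have "\<dots> = card R1 / 2" using assms(4) K by (simp add: p_def field_simps)
      finally have "p ^ 2 * (card R1 / 2) \<le> p ^ 2 * (card R1 - p * (\<Sum>e\<in>R1. real (card (B e))))"
        by (intro mult_left_mono) auto
      then have "p ^ 2 * card R1 \<le> D * card S" using Q1 Q2 by simp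
      then have "card R1 \<le> D * card S / p ^ 2" using p(1) by (simp add: field_simps)
      also have "\<dots> = 4 * D ^ 3 * K ^ 2 * card S"
        using assms(4) K by (simp add: p_def field_simps power2_eq_square power3_eq_cube)
      finally have "2 * D * K ^ 2 * card R1 \<le> 2 * D * K ^ 2 * (4 * D ^ 3 * K ^ 2 * card S)"
        using assms(4) by (intro mult_left_mono) auto
      also have "\<dots> = card S * (8 * D ^ 4 * K ^ 4)" by (simp add: power_def)
      finally have "card S * (real (card S) - 1) \<le> card S * (8 * D ^ 4 * K ^ 4)"
        using S1 unfolding K_def[symmetric] by linarith
      then show ?thesis using Spos by simp
    qed
    moreover have "1 \<le> D ^ 4 * K ^ 4"
      using mult_mono[OF D1[of 4] k1[of 4]] D1[of 4] by (simp add: K_def)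
    ultimately show ?thesis unfolding K_def by linarith
  qed
  then have "(D + 1) * card S \<le> (2 * D) * (9 * D ^ 4 * (real k + 1) ^ 4)"
    using assms(4) by (intro mult_mono) auto
  then have "card W \<le> (2 * D) * (9 * D ^ 4 * (real k + 1) ^ 4)" using S(3) by linarith
  also have "\<dots> = 18 * D ^ 5 * (real k + 1) ^ 4" by (simp add: power_def)
  finally show ?thesis .
qed

section \<open>Subpolynomial functions and nowhere-dense classes\<close>

text \<open>The summand 2 leaves room for rounding. Using half of the exponent, it is absorbed into
  \<open>3 * n powr (r / 2)\<close>, which is below \<open>n powr r\<close> for large
  \<open>n\<close>.\<close>

lemma subpolynomialI:
  fixes g :: "nat \<Rightarrow> nat"
  assumes pos: "\<And>n. 0 < g n"
    and le: "\<And>\<epsilon> :: real. 0 < \<epsilon> \<Longrightarrow> \<exists>n0. \<forall>n\<ge>n0. real (g n) \<le> n powr \<epsilon> + 2"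
  shows "subpolynomial g"
  unfolding subpolynomial_def
proof
  show "\<forall>\<^sub>F n in sequentially. 0 < g n" using pos by simp
  show "(\<lambda>n. ln (real (g n)) / ln (real n)) \<longlonglongrightarrow> 0"
  proof (rule LIMSEQ_I)
    fix r :: real assume r: "0 < r"
    obtain n0 where n0: "\<And>n :: nat. n0 \<le> n \<Longrightarrow> real (g n) \<le> n powr (r / 2) + 2"
      using le[of "r / 2"] r by auto
    define n1 where "n1 = max n0 (max 2 (nat \<lceil>exp (2 * ln 3 / r)\<rceil> + 1))"
    have "norm (ln (real (g n)) / ln (real n) - 0) < r" if n: "n1 \<le> n" for n :: nat
    proof -
      have n2: "n0 \<le> n" "2 \<le> n" "exp (2 * ln 3 / r) < n"
        using n unfolding n1_def by linarith+
      then have "ln (exp (2 * ln 3 / r)) < ln (real n)" by (subst ln_less_cancel_iff) auto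
      then have ln3: "ln 3 < r / 2 * ln n" using r by (simp add: field_simps)
      have lnpos: "ln (real n) > 0" using n2 by simp
      have "1 \<le> n powr (r / 2)" using n2 r by (intro ge_one_powr_ge_zero) auto
      then have "real (g n) \<le> 3 * n powr (r / 2)" using n0[OF n2(1)] by linarith
      then have "ln (real (g n)) \<le> ln (3 * n powr (r / 2))"
        using pos[of n] n2 by (subst ln_le_cancel_iff) auto
      also have "\<dots> = ln 3 + r / 2 * ln n" using n2 by (simp add: ln_mult ln_powr)
      also have "\<dots> < r * ln n" using ln3 by (simp add: field_simps)
      finally have "ln (real (g n)) / ln n < r" using lnpos by (simp add: field_simps)
      moreover have "0 \<le> ln (real (g n)) / ln n" using lnpos pos[of n] by simp
      ultimately show ?thesis by simp
    qed
    then show "\<exists>no. \<forall>n\<ge>no. norm (ln (real (g n)) / ln (real n) - 0) < r" by blast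
  qed
qed

lemma subpolynomialD:
  fixes \<epsilon> :: real
  assumes "subpolynomial g" "0 < \<epsilon>"
  shows "\<forall>\<^sub>F n in sequentially. real (g n) \<le> n powr \<epsilon>"
proof -
  have lim: "(\<lambda>n. ln (real (g n)) / ln (real n)) \<longlonglongrightarrow> 0"
    using assms(1) by (simp add: subpolynomial_def)
  have "\<forall>\<^sub>F n in sequentially. 0 < g n" using assms(1) by (simp add: subpolynomial_def)
  moreover have "\<forall>\<^sub>F n in sequentially. ln (real (g n)) / ln (real n) < \<epsilon>"
    using order_tendstoD(2)[OF lim assms(2)] .
  moreover have "\<forall>\<^sub>F n in sequentially. (2::nat) \<le> n" by (rule eventually_ge_at_top)
  ultimately show ?thesis
  proof eventually_elim
    case (elim n)
    then have "ln (real (g n)) \<le> \<epsilon> * ln n" by (simp add: field_simps)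
    then have "exp (ln (real (g n))) \<le> exp (\<epsilon> * ln n)" by simp
    then show ?case using elim(1,3) by (simp add: powr_def)
  qed
qed

section \<open>Attaining, comparing and bounding the maxima\<close>

lemma nabla_le_attained:
  assumes "simple_graph G"
  obtains F :: "nat pair_pre_digraph" and s where "simple_graph F" "avg_degree F = nabla_le k G"
    "\<And>e. e \<in> edge_reps F \<Longrightarrow> s e \<le> k" "contains_subgraph G (subdivided F s)"
proof -
  have "nabla_le k G \<in> {avg_degree F | F :: nat pair_pre_digraph.
     simple_graph F \<and> (\<exists>H \<in> le_subdivisions k F. contains_induced_subgraph G H)}"
    unfolding nabla_le_def by (intro Max_in nabla_le_values assms)
  then obtain F :: "nat pair_pre_digraph" and H where F: "nabla_le k G = avg_degree F" "simple_graph F"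
    "H \<in> le_subdivisions k F" "contains_induced_subgraph G H" by blast
  then obtain s where s: "H = subdivided F s" "\<And>e. e \<in> edge_reps F \<Longrightarrow> s e \<le> k"
    unfolding le_subdivisions_def by blast
  show ?thesis
    by (rule that[of F s]) (use F s contains_induced_imp_contains in auto)
qed

lemma nabla_eq_le_nabla_le:
  assumes "simple_graph G"
  shows "nabla_eq k G \<le> nabla_le k G"
  unfolding nabla_eq_def nabla_le_def
proof (rule Max_mono)
  have "k_subdivision k F \<in> le_subdivisions k F" for F :: "nat pair_pre_digraph"
    unfolding le_subdivisions_def k_subdivision_def by (intro CollectI exI[of _ "\<lambda>_. k"]) simp
  then show "{avg_degree F | F :: nat pair_pre_digraph.
      simple_graph F \<and> contains_induced_subgraph G (k_subdivision k F)}
    \<subseteq> {avg_degree F | F :: nat pair_pre_digraph.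
      simple_graph F \<and> (\<exists>H \<in> le_subdivisions k F. contains_induced_subgraph G H)}"
    by blast
qed (use nabla_eq_values[OF assms] nabla_le_values[OF assms] in auto)

text \<open>Infinitely many graphs may have order \<open>n\<close>, but the graphs \<open>F\<close>
  found in them have at most \<open>n\<close> vertices and hence only finitely many average degrees.
  This provides a bound for every fixed order, including the small ones.\<close>

lemma nabla_le_bounded: "\<exists>b. \<forall>G :: 'a pair_pre_digraph. simple_graph G \<and> card (pverts G) = n \<longrightarrow> nabla_le k G \<le> real b"
proof -
  let ?A = "{avg_degree F | F :: nat pair_pre_digraph. simple_graph F \<and> card (pverts F) \<le> n}"
  have "nabla_le k G \<le> real (nat \<lceil>Max ?A\<rceil>)" if G: "simple_graph G" "card (pverts G) = n"
    for G :: "'a pair_pre_digraph"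
  proof -
    obtain F :: "nat pair_pre_digraph" and s where
      F: "simple_graph F" "avg_degree F = nabla_le k G" "contains_subgraph G (subdivided F s)"
      using nabla_le_attained[OF G(1), of k] by blast
    have "card (pverts F) \<le> card (pverts (subdivided F s))"
      using F(1) by (simp add: simple_graph_def card_pverts_subdivided)
    also have "\<dots> \<le> n"
      using contains_subgraph_card_le[OF _ F(3)] G by (simp add: simple_graph_def)
    finally have "avg_degree F \<in> ?A" using F(1) by blast
    then have "avg_degree F \<le> Max ?A" using finite_avg_degrees by (intro Max_ge) auto
    then show ?thesis using F(2) by linarith
  qed
  then show ?thesis by blast
qed

section \<open>From (a) to (b)\<close>

lemma nowhere_dense_nabla_le:
  fixes \<G> :: "'a pair_pre_digraph set" and \<epsilon> :: real
  assumes \<G>: "\<And>G. G \<in> \<G> \<Longrightarrow> simple_graph G" and nd: "nowhere_dense \<G>" and \<epsilon>: "0 < \<epsilon>"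
  shows "\<exists>n0. \<forall>G\<in>\<G>. \<forall>G'. simple_graph G' \<and> induced_subgraph (with_proj G') (with_proj G) \<and>
    n0 \<le> card (pverts G') \<longrightarrow> nabla_le k G' \<le> card (pverts G') powr \<epsilon>"
proof -
  obtain h where h: "\<And>G k. G \<in> \<G> \<Longrightarrow>
     \<not> (\<exists>F :: nat pair_pre_digraph. complete_digraph (h k) (with_proj F) \<and>
          (\<exists>H \<in> le_subdivisions k F. contains_subgraph G H))"
    using nd unfolding nowhere_dense_def by blast
  obtain i where i: "\<forall>t\<ge>1. \<exists>n0. \<forall>n\<ge>n0. \<forall>(E :: 'a rel) W R I L.
    topological_model E W R I L \<and> W \<noteq> {} \<and> card W \<le> n \<and> n powr \<epsilon> * card W \<le> 2 * card R \<longrightarrow>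
    (\<exists>T J. card T = t \<and> topological_model E T (nsets T 2) J (2 ^ i * (L + 1) - 1))"
    using dense_imp_clique_model[OF \<epsilon>, where ?'b = 'a] by (rule exE)
  define M where "M = 2 ^ i * (k + 1) - 1"
  \<comment> \<open>With at least two branch vertices, each lies on an arc and hence in
    \<open>G\<close>; afterwards the clique is cut down to order \<open>h M\<close>.\<close>
  define t where "t = max 2 (h M)"
  have "1 \<le> t" by (simp add: t_def)
  from i[rule_format, OF this] obtain n0 where "\<forall>n\<ge>n0. \<forall>(E :: 'a rel) W R I L.
    topological_model E W R I L \<and> W \<noteq> {} \<and> card W \<le> n \<and> n powr \<epsilon> * card W \<le> 2 * card R \<longrightarrow>
    (\<exists>T J. card T = t \<and> topological_model E T (nsets T 2) J (2 ^ i * (L + 1) - 1))" by (rule exE)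
  then have n0: "\<And>n :: nat. \<And>(E :: 'a rel) W R I. n0 \<le> n \<Longrightarrow> topological_model E W R I k \<Longrightarrow>
    W \<noteq> {} \<Longrightarrow> card W \<le> n \<Longrightarrow> n powr \<epsilon> * card W \<le> 2 * card R \<Longrightarrow>
    \<exists>T J. card T = t \<and> topological_model E T (nsets T 2) J M"
    unfolding M_def by simp
  have "nabla_le k G' \<le> card (pverts G') powr \<epsilon>"
    if G: "G \<in> \<G>" "simple_graph G'" "induced_subgraph (with_proj G') (with_proj G)" "n0 \<le> card (pverts G')"
    for G G'
  proof (rule ccontr)
    assume dense: "\<not> ?thesis"
    have "pair_graph G" using \<G>[OF G(1)] by (simp add: simple_graph_def)
    then interpret G: pair_graph G .
    have "pair_graph G'" using G(2) by (simp add: simple_graph_def)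
    then interpret G': pair_graph G' .
    have "subgraph (with_proj G') (with_proj G)" using G(3) unfolding induced_subgraph_def by (rule conjunct1)
    then have sub: "parcs G' \<subseteq> parcs G" unfolding subgraph_def by simp
    have symG: "sym (parcs G)" by (rule symI) (rule G.arcs_symmetric)
    obtain F :: "nat pair_pre_digraph" and s where
      F: "simple_graph F" "avg_degree F = nabla_le k G'" and
      s: "\<And>e. e \<in> edge_reps F \<Longrightarrow> s e \<le> k" and cs: "contains_subgraph G' (subdivided F s)"
      by (rule nabla_le_attained[OF G(2), of k]) (rule that)
    interpret F: pair_graph F using F(1) by (simp add: simple_graph_def)
    obtain g where g: "inj_on g (pverts (subdivided F s))" "g ` pverts (subdivided F s) \<subseteq> pverts G'"
      "\<And>x y. (x, y) \<in> parcs (subdivided F s) \<Longrightarrow> (g x, g y) \<in> parcs G'"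
      using contains_subgraphE[OF cs] by blast
    have garc: "(g x, g y) \<in> parcs G" if "(x, y) \<in> parcs (subdivided F s)" for x y
      using g(3)[OF that] sub by blast
    define W where "W = (g \<circ> Inl) ` pverts F"
    define R where "R = (\<lambda>(a, b). {g (Inl a), g (Inl b)}) ` parcs F"
    \<comment> \<open>The model uses the arcs of \<open>G\<close>, where cliques are excluded, while
      \<open>n\<close> is the order of the smaller graph \<open>G'\<close>, relative to which the
      average degree is large.\<close>
    have "\<exists>I. topological_model (parcs G) W R I k \<and> \<Union> (I ` R) \<subseteq> g ` pverts (subdivided F s)"
      unfolding W_def R_def by (rule embedded_subdivision_model[OF F.pair_graph symG s g(1) garc])
    then obtain I where m: "topological_model (parcs G) W R I k" by blast
    have vert: "Inl ` pverts F \<subseteq> pverts (subdivided F s)" by (auto simp: subdivided_def)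
    have inj: "inj_on (g \<circ> Inl) (pverts F)"
      using inj_on_subset[OF g(1) vert] by (simp add: comp_inj_on)
    have cW: "card W = card (pverts F)" unfolding W_def using inj by (rule card_image)
    have "W \<subseteq> pverts G'" unfolding W_def image_comp[symmetric] using vert g(2) by blast
    then have cWG: "card W \<le> card (pverts G')" using G'.pair_finite_verts by (intro card_mono)
    have "card (parcs F) = 2 * card ((\<lambda>(a, b). {(g \<circ> Inl) a, (g \<circ> Inl) b}) ` parcs F)"
    proof (rule card_sym_arcs[OF F.pair_finite_arcs _ inj])
      show "sym (parcs F)" by (rule symI) (rule F.arcs_symmetric)
      show "parcs F \<subseteq> pverts F \<times> pverts F" using F.in_arcsD1 F.in_arcsD2 by auto
      show "(a, a) \<notin> parcs F" for a using F.no_loops' by blast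
    qed
    then have cR: "card (parcs F) = 2 * card R" by (simp add: R_def)
    have Wne: "W \<noteq> {}" using F(1) by (auto simp: W_def simple_graph_def)
    then have "card W > 0" using topological_modelD(1)[OF m] by (simp add: card_gt_0_iff)
    moreover have "card (pverts G') powr \<epsilon> < 2 * real (card R) / card W"
      using dense F(2) unfolding avg_degree_def cW cR by simp
    ultimately have "card (pverts G') powr \<epsilon> * card W \<le> 2 * card R" by (simp add: field_simps)
    then obtain T J where T: "card T = t" "topological_model (parcs G) T (nsets T 2) J M"
      using n0[OF G(4) m Wne cWG] by blast
    have "T \<subseteq> pverts G"
    proof
      fix x assume x: "x \<in> T"
      have "T \<noteq> {x}" using T(1) by (auto simp: t_def)
      then obtain y where y: "y \<in> T" "y \<noteq> x" using x by blast
      then have "{x, y} \<in> nsets T 2" using x by simp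
      then have l: "linked (parcs G) (J {x, y}) x y" using topological_modelD(4)[OF T(2)] by blast
      obtain p l where p: "walk_via (parcs G) (J {x, y}) p l" "p 0 = x" "p l = y"
        using l unfolding linked_def by blast
      have "0 < l" using p(2,3) y(2) by (cases l) auto
      then have "(x, p (Suc 0)) \<in> parcs G" using p(1,2) by (auto simp: walk_via_def)
      then show "x \<in> pverts G" by (rule G.in_arcsD1)
    qed
    moreover obtain T' where T': "T' \<subseteq> T" "card T' = h M"
      using obtain_subset_with_card_n[of "h M" T] T(1) by (auto simp: t_def)
    moreover have "topological_model (parcs G) T' (nsets T' 2) J M"
      by (rule topological_model_mono[OF T(2) T'(1) nsets_mono[OF T'(1)]]) auto
    ultimately show False
      using clique_model_imp_contains_subgraph[OF G.pair_graph, of T' J M] h[OF G(1), of M]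
      unfolding T'(2)[symmetric] by (meson order_trans)
  qed
  then show ?thesis by blast
qed

text \<open>One function has to serve every \<open>\<epsilon>\<close>. The least positive bound
  valid for all induced subgraphs of order \<open>n\<close> does, being below the bound obtained
  from each single \<open>\<epsilon>\<close>.\<close>

lemma nowhere_dense_imp_nabla_le_subpolynomial:
  fixes \<G> :: "'a pair_pre_digraph set"
  assumes \<G>: "\<And>G. G \<in> \<G> \<Longrightarrow> simple_graph G" and nd: "nowhere_dense \<G>"
  shows "\<exists>f. subpolynomial_snd f \<and>
    (\<forall>k. \<forall>G \<in> \<G>. \<forall>G'. simple_graph G' \<and> induced_subgraph (with_proj G') (with_proj G) \<longrightarrow>
       nabla_le k G' \<le> real (f k (card (pverts G'))))"
proof -
  define P where "P = (\<lambda>k n b. 0 < b \<and> (\<forall>G\<in>\<G>. \<forall>G'. simple_graph G' \<and>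
    induced_subgraph (with_proj G') (with_proj G) \<and> card (pverts G') = n \<longrightarrow> nabla_le k G' \<le> real b))"
  define f where "f = (\<lambda>k n. LEAST b. P k n b)"
  have "\<exists>b. P k n b" for k n
  proof -
    obtain b where "\<And>G :: 'a pair_pre_digraph. simple_graph G \<Longrightarrow> card (pverts G) = n \<Longrightarrow> nabla_le k G \<le> real b"
      using nabla_le_bounded[of n k, where ?'a = 'a] by blast
    then have "nabla_le k G' \<le> real (Suc b)" if "simple_graph G'" "card (pverts G') = n"
      for G' :: "'a pair_pre_digraph"
      using that by fastforce
    then have "P k n (Suc b)" unfolding P_def by blast
    then show ?thesis by blast
  qed
  then have f: "P k n (f k n)" for k n unfolding f_def by (rule LeastI_ex)
  have "subpolynomial (f k)" for k
  proof (rule subpolynomialI)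
    show "0 < f k n" for n using f[of k n] by (simp add: P_def)
    fix \<epsilon> :: real assume "0 < \<epsilon>"
    then obtain n0 where n0: "\<And>G G'. G \<in> \<G> \<Longrightarrow> simple_graph G' \<Longrightarrow>
      induced_subgraph (with_proj G') (with_proj G) \<Longrightarrow> n0 \<le> card (pverts G') \<Longrightarrow>
      nabla_le k G' \<le> card (pverts G') powr \<epsilon>"
      using nowhere_dense_nabla_le[OF \<G> nd, of \<epsilon> k] by blast
    have "real (f k n) \<le> n powr \<epsilon> + 2" if n: "n0 \<le> n" for n
    proof -
      define b where "b = Suc (nat \<lceil>n powr \<epsilon>\<rceil>)"
      have "n powr \<epsilon> \<le> real b" unfolding b_def by linarith
      then have "nabla_le k G' \<le> real b" if "G \<in> \<G>" "simple_graph G'"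
        "induced_subgraph (with_proj G') (with_proj G)" "card (pverts G') = n" for G G'
        using n0[OF that(1-3)] n that(4) by simp
      then have "P k n b" unfolding P_def b_def by blast
      then have "f k n \<le> b" unfolding f_def by (rule Least_le)
      moreover have "real b \<le> n powr \<epsilon> + 2"
        using powr_ge_zero[of n \<epsilon>] unfolding b_def by linarith
      ultimately show ?thesis by linarith
    qed
    then show "\<exists>n0. \<forall>n\<ge>n0. real (f k n) \<le> n powr \<epsilon> + 2" by blast
  qed
  then have "subpolynomial_snd f" by (simp add: subpolynomial_snd_def)
  moreover have "nabla_le k G' \<le> real (f k (card (pverts G')))"
    if "G \<in> \<G>" "simple_graph G'" "induced_subgraph (with_proj G') (with_proj G)" for k G G'
    using f[of k "card (pverts G')"] that unfolding P_def by blast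
  ultimately show ?thesis by blast
qed

section \<open>From (c) to (a)\<close>

text \<open>\<open>G'\<close> is induced by all branch and inner vertices, so its order is
  controlled by \<open>t\<close> from both sides. \<open>D\<close> is quantified inside the
  conclusion because its eventual value depends on the order of \<open>G'\<close>.\<close>

lemma clique_subdivision_order_bound:
  fixes G :: "'a pair_pre_digraph"
  assumes G: "pair_graph G" and F: "complete_digraph t (with_proj (F :: nat pair_pre_digraph))"
    and H: "H \<in> le_subdivisions k F" "contains_subgraph G H"
  obtains G' where "pair_graph G'" "induced_subgraph (with_proj G') (with_proj G)"
    "t \<le> card (pverts G')" "card (pverts G') \<le> (k + 1) * t ^ 2"
    "\<forall>D\<ge>1. (\<forall>j\<le>k. nabla_eq j G' \<le> D) \<longrightarrow> real t \<le> 18 * D ^ 5 * (real k + 1) ^ 4"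
proof (cases "t = 0")
  case True
  \<comment> \<open>For \<open>t = 0\<close> the null graph is a witness, as a
    \<open>pair_graph\<close> may be empty.\<close>
  have "pair_graph \<lparr>pverts = {}, parcs = {}\<rparr>" by unfold_locales (auto simp: symmetric_def sym_def)
  then interpret E: pair_graph "\<lparr>pverts = {}, parcs = {}\<rparr> :: 'a pair_pre_digraph" .
  interpret G: pair_graph G by fact
  have "induced_subgraph (with_proj \<lparr>pverts = {}, parcs = {}\<rparr>) (with_proj G)"
    using G.wf_digraph E.wf_digraph by (auto simp: induced_subgraph_def subgraph_def compatible_def)
  then show ?thesis using that[of "\<lparr>pverts = {}, parcs = {}\<rparr>"] True E.pair_graph by simp
next
  case False
  interpret G: pair_graph G by fact
  have Fc: "finite (pverts F)" "card (pverts F) = t"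
    "parcs F = {(u, v). (u, v) \<in> pverts F \<times> pverts F \<and> u \<noteq> v}"
    using F by (auto simp: complete_digraph_pair_def)
  interpret F: pair_graph F
    using F by (intro pair_graphI_graph) (simp add: complete_digraph_def)
  obtain s where s: "H = subdivided F s" "\<And>e. e \<in> edge_reps F \<Longrightarrow> s e \<le> k"
    using H(1) unfolding le_subdivisions_def by blast
  have symG: "sym (parcs G)" by (rule symI) (rule G.arcs_symmetric)
  obtain g where g: "inj_on g (pverts (subdivided F s))" "g ` pverts (subdivided F s) \<subseteq> pverts G"
    "\<And>x y. (x, y) \<in> parcs (subdivided F s) \<Longrightarrow> (g x, g y) \<in> parcs G"
    using contains_subgraphE[OF H(2)[unfolded s(1)]] by blast
  define W where "W = (g \<circ> Inl) ` pverts F"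
  define R where "R = (\<lambda>(a, b). {g (Inl a), g (Inl b)}) ` parcs F"
  have "\<exists>I. topological_model (parcs G) W R I k \<and> \<Union> (I ` R) \<subseteq> g ` pverts (subdivided F s)"
    unfolding W_def R_def by (rule embedded_subdivision_model[OF F.pair_graph symG s(2) g(1,3)])
  then obtain I where m: "topological_model (parcs G) W R I k"
    and IG: "\<Union> (I ` R) \<subseteq> g ` pverts (subdivided F s)" by blast
  have vert: "Inl ` pverts F \<subseteq> pverts (subdivided F s)" by (auto simp: subdivided_def)
  have inj: "inj_on (g \<circ> Inl) (pverts F)"
    using inj_on_subset[OF g(1) vert] by (simp add: comp_inj_on)
  have cW: "card W = t" unfolding W_def Fc(2)[symmetric] using inj by (rule card_image)
  have R: "R = nsets W 2"
  proof
    show "nsets W 2 \<subseteq> R"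
    proof
      fix e assume "e \<in> nsets W 2"
      then obtain a b where "e = {g (Inl a), g (Inl b)}" "a \<in> pverts F" "b \<in> pverts F" "a \<noteq> b"
        unfolding nsets_2_eq W_def by auto
      moreover from this have "(a, b) \<in> parcs F" using Fc(3) by blast
      ultimately show "e \<in> R" unfolding R_def by blast
    qed
  qed (use topological_modelD(2)[OF m] in blast)
  define Y where "Y = W \<union> \<Union> (I ` nsets W 2)"
  have "W \<subseteq> pverts G" unfolding W_def image_comp[symmetric] using vert g(2) by blast
  moreover have "\<Union> (I ` nsets W 2) \<subseteq> pverts G" using order_trans[OF IG g(2)] unfolding R .
  ultimately have YG: "Y \<subseteq> pverts G" unfolding Y_def by (rule Un_least)
  then have finY: "finite Y" using G.pair_finite_verts by (rule finite_subset)
  have tY: "t \<le> card Y" unfolding cW[symmetric] using finY by (intro card_mono) (auto simp: Y_def)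
  note mD = topological_modelD[OF m[unfolded R]]
  have cY: "card Y \<le> (k + 1) * t ^ 2"
  proof -
    have "card (\<Union> (I ` nsets W 2)) \<le> (\<Sum>e\<in>nsets W 2. card (I e))" using mD(3) by (rule card_UN_le)
    also have "\<dots> \<le> (\<Sum>e\<in>nsets W 2. k)" using mD(7) by (rule sum_mono)
    also have "\<dots> = k * card (nsets W 2)" by simp
    also have "card (nsets W 2) \<le> t ^ 2"
    proof -
      have "card (nsets W 2) = t * (t - 1) div 2" by (simp add: card_nsets cW choose_two)
      also have "\<dots> \<le> t * (t - 1)" by (rule div_le_dividend)
      also have "\<dots> \<le> t ^ 2" by (simp add: power2_eq_square)
      finally show ?thesis .
    qed
    finally have "card (\<Union> (I ` nsets W 2)) \<le> k * t ^ 2" by simp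
    moreover have "t \<le> t ^ 2" by (simp add: power2_eq_square)
    ultimately show ?thesis using card_Un_le[of W "\<Union> (I ` nsets W 2)"] cW unfolding Y_def by simp
  qed
  define G' where "G' = \<lparr>pverts = Y, parcs = parcs G \<inter> Y \<times> Y\<rparr>"
  have "sym (parcs G \<inter> Y \<times> Y)" using symG by (auto simp: sym_def)
  then have "symmetric (with_proj G')" by (simp add: symmetric_def G'_def)
  then have "pair_graph G'"
    using finY G.pair_finite_arcs G.pair_no_loops by unfold_locales (auto simp: G'_def)
  then interpret G': pair_graph G' .
  have ind: "induced_subgraph (with_proj G') (with_proj G)"
    using YG G.wf_digraph G'.wf_digraph
    by (auto simp: induced_subgraph_def subgraph_def compatible_def G'_def)
  have simple: "simple_graph G'"
    using G'.pair_graph tY False by (auto simp: simple_graph_def G'_def)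
  have "linked (parcs G') (I {u, v}) u v" if uv: "{u, v} \<in> nsets W 2" for u v
  proof -
    have "u \<in> Y" "v \<in> Y" "I {u, v} \<subseteq> Y" using uv by (auto simp: Y_def)
    then show ?thesis using linked_restrict[OF mD(4)[OF uv]] by (simp add: G'_def)
  qed
  then have m': "topological_model (parcs G') W (nsets W 2) I k"
    using m[unfolded R] unfolding topological_model_def by blast
  have bound: "real t \<le> 18 * D ^ 5 * (real k + 1) ^ 4"
    if D: "1 \<le> D" "\<And>j. j \<le> k \<Longrightarrow> nabla_eq j G' \<le> D" for D
    unfolding cW[symmetric]
  proof (rule clique_model_order_bound[OF G'.pair_finite_arcs _ _ D(1) m' _ finY])
    show "sym (parcs G')" by (rule symI) (rule G'.arcs_symmetric)
    show "(x, x) \<notin> parcs G'" for x using G'.no_loops' by blast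
    show "W \<union> \<Union> (I ` nsets W 2) \<subseteq> Y" by (simp add: Y_def)
    fix X Q J j
    assume X: "X \<subseteq> Y" "X \<noteq> {}" "j \<le> k" "induced_model (parcs G') X Q J k" "\<forall>e\<in>Q. card (J e) = j"
    obtain F' :: "nat pair_pre_digraph" where F': "simple_graph F'" "avg_degree F' = 2 * card Q / card X"
      "contains_induced_subgraph G' (k_subdivision j F')"
      using induced_model_imp_contains_induced_subgraph[OF G'.pair_graph X(4), of j] X(1,2,5)
      by (auto simp: G'_def)
    have "avg_degree F' \<le> nabla_eq j G'"
      unfolding nabla_eq_def using F'(1,3) by (intro Max_ge nabla_eq_values simple) blast
    also have "\<dots> \<le> D" using X(3) by (rule D(2))
    finally have "2 * card Q / card X \<le> D" using F'(2) by simp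
    moreover have "card X > 0" using X(1,2) finY by (meson card_gt_0_iff finite_subset)
    ultimately show "2 * card Q \<le> D * card X" by (simp add: field_simps)
  qed
  show ?thesis
    by (rule that[OF G'.pair_graph ind]) (use tY cY bound in \<open>auto simp: G'_def\<close>)
qed

text \<open>Each \<open>k\<close> receives its own clique order. Only the finitely many functions
  \<open>f j\<close> with \<open>j \<le> k\<close> enter, so a common threshold \<open>n0\<close>
  exists.\<close>

lemma nabla_eq_subpolynomial_imp_nowhere_dense:
  fixes \<G> :: "'a pair_pre_digraph set"
  assumes \<G>: "\<And>G. G \<in> \<G> \<Longrightarrow> simple_graph G" and f: "subpolynomial_snd f"
    and le: "\<And>k G G'. G \<in> \<G> \<Longrightarrow> simple_graph G' \<Longrightarrow> induced_subgraph (with_proj G') (with_proj G) \<Longrightarrow>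
       nabla_eq k G' \<le> real (f k (card (pverts G')))"
  shows "nowhere_dense \<G>"
proof -
  have "\<exists>t. \<forall>G\<in>\<G>. \<not> (\<exists>F :: nat pair_pre_digraph. complete_digraph t (with_proj F) \<and>
      (\<exists>H \<in> le_subdivisions k F. contains_subgraph G H))" for k
  proof -
    have "\<forall>\<^sub>F n in sequentially. \<forall>j\<in>{..k}. real (f j n) \<le> n powr (1 / 20)"
      using f subpolynomialD[of "f _" "1 / 20"] unfolding subpolynomial_snd_def
      by (intro eventually_ball_finite) auto
    then obtain n0 where n0: "\<And>n j. n0 \<le> n \<Longrightarrow> j \<le> k \<Longrightarrow> real (f j n) \<le> n powr (1 / 20)"
      unfolding eventually_sequentially by auto
    \<comment> \<open>Four factors \<open>k + 1\<close> come from the order bound and one from the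
      estimate of \<open>N powr (1 / 4)\<close>. The resulting \<open>t \<le> c * sqrt t\<close>
      contradicts \<open>c ^ 2 < t\<close>.\<close>
    define c where "c = 18 * (real k + 1) ^ 5"
    define t where "t = n0 + nat \<lceil>c ^ 2\<rceil> + 1"
    have t: "n0 \<le> t" "c ^ 2 < t" "1 \<le> t" unfolding t_def by linarith+
    have "\<not> (\<exists>F :: nat pair_pre_digraph. complete_digraph t (with_proj F) \<and>
      (\<exists>H \<in> le_subdivisions k F. contains_subgraph G H))" if G: "G \<in> \<G>" for G
    proof
      assume "\<exists>F :: nat pair_pre_digraph. complete_digraph t (with_proj F) \<and>
        (\<exists>H \<in> le_subdivisions k F. contains_subgraph G H)"
      then obtain F :: "nat pair_pre_digraph" and H where
        F: "complete_digraph t (with_proj F)" "H \<in> le_subdivisions k F" "contains_subgraph G H" by blast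
      have "pair_graph G" using \<G>[OF G] by (simp add: simple_graph_def)
      then obtain G' where G': "pair_graph G'" "induced_subgraph (with_proj G') (with_proj G)"
        "t \<le> card (pverts G')" "card (pverts G') \<le> (k + 1) * t ^ 2" and
        bound: "\<forall>D\<ge>1. (\<forall>j\<le>k. nabla_eq j G' \<le> D) \<longrightarrow> real t \<le> 18 * D ^ 5 * (real k + 1) ^ 4"
        by (rule clique_subdivision_order_bound[OF _ F]) (rule that)
      define N where "N = card (pverts G')"
      have N: "1 \<le> N" "n0 \<le> N" using G'(3) t by (auto simp: N_def)
      then have "simple_graph G'" using G'(1) by (auto simp: simple_graph_def N_def)
      then have "nabla_eq j G' \<le> N powr (1 / 20)" if "j \<le> k" for j
        using le[OF G _ G'(2), of j] n0[OF N(2) that] unfolding N_def by linarith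
      moreover have "1 \<le> N powr (1 / 20)" using N by (simp add: ge_one_powr_ge_zero)
      ultimately have "real t \<le> 18 * (N powr (1 / 20)) ^ 5 * (real k + 1) ^ 4" using bound by blast
      also have "(N powr (1 / 20)) ^ 5 = N powr (1 / 4)"
        using N by (simp add: powr_power)
      also have "N powr (1 / 4) \<le> (real k + 1) * sqrt t"
      proof -
        have "real N \<le> real ((k + 1) * t ^ 2)" using G'(4) unfolding N_def by (simp only: of_nat_le_iff)
        then have "N powr (1 / 4) \<le> ((real k + 1) * real t ^ 2) powr (1 / 4)"
          by (intro powr_mono2) (auto simp: algebra_simps)
        also have "\<dots> = (real k + 1) powr (1 / 4) * (real t ^ 2) powr (1 / 4)" by (simp add: powr_mult)
        also have "(real t ^ 2) powr (1 / 4) = sqrt t"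
          using t(3) by (simp add: powr_half_sqrt[symmetric] powr_powr flip: powr_numeral)
        also have "(real k + 1) powr (1 / 4) \<le> (real k + 1) powr 1" by (intro powr_mono) auto
        finally show ?thesis by (simp add: mult_right_mono)
      qed
      finally have "real t \<le> 18 * ((real k + 1) * sqrt t) * (real k + 1) ^ 4"
        by (simp add: mult_right_mono)
      also have "\<dots> = c * sqrt t" by (simp add: c_def power_def)
      finally have "sqrt t * sqrt t \<le> c * sqrt t" by simp
      then have "sqrt t \<le> c" by (rule mult_right_le_imp_le) (use t(3) in simp)
      then have "real t \<le> c ^ 2" by (rule sqrt_le_D)
      then show False using t(2) by simp
    qed
    then show ?thesis by blast
  qed
  then show ?thesis unfolding nowhere_dense_def by metis
qed

theorem theorem5:
  fixes \<G> :: "'a pair_pre_digraph set"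
  assumes "\<And>G. G \<in> \<G> \<Longrightarrow> simple_graph G"
  shows "(nowhere_dense \<G> \<longleftrightarrow>
           (\<exists>f :: nat \<Rightarrow> nat \<Rightarrow> nat. subpolynomial_snd f \<and>
              (\<forall>k. \<forall>G \<in> \<G>. \<forall>G'. simple_graph G' \<and> induced_subgraph (with_proj G') (with_proj G) \<longrightarrow>
                 nabla_le k G' \<le> real (f k (card (pverts G')))))) \<and>
         (nowhere_dense \<G> \<longleftrightarrow>
           (\<exists>f :: nat \<Rightarrow> nat \<Rightarrow> nat. subpolynomial_snd f \<and>
              (\<forall>k. \<forall>G \<in> \<G>. \<forall>G'. simple_graph G' \<and> induced_subgraph (with_proj G') (with_proj G) \<longrightarrow>
                 nabla_eq k G' \<le> real (f k (card (pverts G'))))))"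
    (is "(_ \<longleftrightarrow> ?b) \<and> (_ \<longleftrightarrow> ?c)")
proof -
  have ab: "?b" if "nowhere_dense \<G>"
    using assms that by (rule nowhere_dense_imp_nabla_le_subpolynomial)
  have bc: "?c" if b: ?b
  proof -
    obtain f where f: "subpolynomial_snd f" and le: "\<forall>k. \<forall>G \<in> \<G>. \<forall>G'.
        simple_graph G' \<and> induced_subgraph (with_proj G') (with_proj G) \<longrightarrow>
        nabla_le k G' \<le> real (f k (card (pverts G')))"
      using b by (elim exE conjE)
    show ?thesis
    proof (intro exI[of _ f] conjI f allI ballI impI)
      fix k G G' assume "G \<in> \<G>" "simple_graph G' \<and> induced_subgraph (with_proj G') (with_proj G)"
      then have "nabla_le k G' \<le> real (f k (card (pverts G')))" "simple_graph G'" using le by simp_all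
      then show "nabla_eq k G' \<le> real (f k (card (pverts G')))"
        using nabla_eq_le_nabla_le order_trans by blast
    qed
  qed
  have ca: "nowhere_dense \<G>" if c: ?c
  proof -
    obtain f where f: "subpolynomial_snd f" and le: "\<forall>k. \<forall>G \<in> \<G>. \<forall>G'.
        simple_graph G' \<and> induced_subgraph (with_proj G') (with_proj G) \<longrightarrow>
        nabla_eq k G' \<le> real (f k (card (pverts G')))"
      using c by (elim exE conjE)
    show ?thesis
      by (rule nabla_eq_subpolynomial_imp_nowhere_dense[OF assms f]) (simp_all add: le)
  qed
  show ?thesis
    by (intro conjI iffI) (erule ab, erule ca[OF bc], erule bc[OF ab], erule ca)
qed

end
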